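(* Let $w^+$ and $w^-$ be the radial functions defined in the context, let $(\beta_k^{\pm})_{k\ge 1}$ be the increasing sequence of positive zeros of $w^{\pm}$, and let $\mu_k^{\pm}=(\beta_k^{\pm})^{\alpha+2}$. The set of (radial) eigenvalues of the operator $\tilde F$ on the unit ball $B(0,1)\subset\mathbb{R}^N$ is the set $\{\mu_k^{\pm} : k\ge 1\}$. These eigenvalues are simple in the following sense: if $v$ is an eigenfunction for the eigenvalue $\mu_k^{\pm}$ which is $\mathcal{C}^1$, and $\mathcal{C}^2$ on each point where its first derivative is different from $0$, then there exists a constant $c>0$ such that $v=c\,w^{\pm}\big((\mu_k^{\pm})^{\frac{1}{2+\alpha}}\,\cdot\,\big)$.
   Context: Fix an integer $N\ge 1$, $\alpha>-1$ and $0<a\le A$. For a function $g=g(r)$, $r>0$, set $\mathcal{M}_{a,A}(r,g',g'')=\Gamma_1 g''+\Gamma_2\frac{N-1}{r}g'$, where $\Gamma_1=A$ if $g''>0$, $\Gamma_1=a$ if $g''<0$, $\Gamma_2=A$ if $g'>0$, $\Gamma_2=a$ if $g'<0$, and $\tilde F(r,g',g'')=|g'|^\alpha\mathcal{M}_{a,A}(r,g',g'')$. This is the expression, for radial functions $u(x)=g(|x|)$ on $\mathbb{R}^N$, of $|\nabla u|^\alpha\mathcal{M}_{a,A}(D^2u)$ with $\mathcal{M}_{a,A}(M)=A\,\mathrm{tr}(M^+)-a\,\mathrm{tr}(M^-)$ the Pucci operator. For functions that are not $\mathcal{C}^2$, $\tilde F(r,g',g'')$ is understood as $\Gamma_1\frac{d}{dr}\big(\frac{|g'|^\alpha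 g'}{1+\alpha}\big)+\Gamma_2\frac{N-1}{r}|g'|^\alpha g'$, the derivative being taken in the distributional sense (and $\Gamma_1$ being determined by the sign of that derivative). $w^+$ (respectively $w^-$) denotes the unique $\mathcal{C}^1$ solution on $[0,\infty[$ of $|w'|^\alpha\mathcal{M}_{a,A}(r,w',w'')=-|w|^\alpha w$ in $\mathbb{R}^+$, $w'(0)=0$, with $w(0)=1$ (respectively $w(0)=-1$). Both functions have infinitely many zeros, forming increasing sequences. A real number $\mu$ is a (radial) eigenvalue of $\tilde F$ on $B(0,1)$ if there is a radial function $v\not\equiv 0$ (an eigenfunction for $\mu$), $\mathcal{C}^1$ on $[0,1]$ and $\mathcal{C}^2$ on each point where $v'\ne 0$, such that $\tilde F(r,v',v'')=-\mu|v|^\alpha v$ in $B(0,1)$ and $v(1)=0$; being radial and $\mathcal{C}^1$, $v$ satisfies $v'(0)=0$.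
   Formalization: When an eigenvalue is both some μ_k^+ and some μ_j^- (e.g. a=A, where w^-=-w^+), the eigenfunction may be a positive multiple of the dilated w^+ or of the dilated w^-; the claim as written fails there. Otherwise it is unchanged. *)

theory Defs
  imports "HOL-Analysis.Analysis"
begin

text \<open>
  Radial functions on \<open>\<real>\<^sup>N\<close>, or on the unit ball, are represented by their profiles
  \<open>g :: real \<Rightarrow> real\<close>, \<open>r = |x|\<close>. Only the values on \<open>[0,\<infinity>)\<close>, respectively \<open>[0,1]\<close>, matter.
\<close>

definition test_function :: "real set \<Rightarrow> (real \<Rightarrow> real) \<Rightarrow> bool" where
  "test_function I \<psi> \<longleftrightarrow>
     (\<forall>n x. ((deriv ^^ n) \<psi>) differentiable (at x)) \<and>
     compact (closure {x. \<psi> x \<noteq> 0}) \<and> closure {x. \<psi> x \<noteq> 0} \<subseteq> I"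

definition locally_integrable_on :: "real set \<Rightarrow> (real \<Rightarrow> real) \<Rightarrow> bool" where
  "locally_integrable_on I f \<longleftrightarrow> (\<forall>K. compact K \<longrightarrow> K \<subseteq> I \<longrightarrow> set_integrable lborel K f)"

definition has_distributional_derivative_on ::
    "real set \<Rightarrow> (real \<Rightarrow> real) \<Rightarrow> (real \<Rightarrow> real) \<Rightarrow> bool" where
  "has_distributional_derivative_on I f h \<longleftrightarrow>
     locally_integrable_on I f \<and> locally_integrable_on I h \<and>
     (\<forall>\<psi>. test_function I \<psi> \<longrightarrow>
        (LINT x:I|lborel. f x * deriv \<psi> x) = - (LINT x:I|lborel. h x * \<psi> x))"

text \<open>\<open>C\<^sup>1\<close> on a set, with derivative \<open>g'\<close>; the derivative is one-sided at end points.\<close>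

definition C1_on :: "real set \<Rightarrow> (real \<Rightarrow> real) \<Rightarrow> (real \<Rightarrow> real) \<Rightarrow> bool" where
  "C1_on J g g' \<longleftrightarrow>
     (\<forall>r\<in>J. (g has_real_derivative g' r) (at r within J)) \<and> continuous_on J g'"

text \<open>
  The coefficients \<open>\<Gamma>\<^sub>1\<close> and \<open>\<Gamma>\<^sub>2\<close>. The value at \<open>t = 0\<close> plays no role, since the
  coefficient is always multiplied by a quantity that vanishes with \<open>t\<close>.
\<close>

definition pucci_coeff :: "real \<Rightarrow> real \<Rightarrow> real \<Rightarrow> real" where
  "pucci_coeff a A t = (if t > 0 then A else a)"

text \<open>
  The equation \<open>F(r,g',g'') = f\<close> on an open set \<open>I \<subseteq> (0,\<infinity>)\<close>, where \<open>F\<close> is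
  \<open>|g'|\<^sup>\<alpha> (\<Gamma>\<^sub>1 g'' + \<Gamma>\<^sub>2 ((N - 1) / r) g')\<close>, understood in the sense
  \<open>\<Gamma>\<^sub>1 d/dr (|g'|\<^sup>\<alpha> g' / (1 + \<alpha>)) + \<Gamma>\<^sub>2 ((N - 1) / r) |g'|\<^sup>\<alpha> g' = f\<close> with a distributional
  derivative. For \<open>\<Gamma>\<^sub>1\<close> to be determined by the sign of that distribution, the latter has to
  be represented by a (locally integrable) function \<open>h\<close>, and the equation holds almost everywhere.
  Since \<open>0 powr \<alpha> = 0\<close>, the expression \<open>\<bar>t\<bar> powr \<alpha> * t\<close> is \<open>0\<close> at \<open>t = 0\<close> for every \<open>\<alpha> > -1\<close>,
  which is its continuous extension.
\<close>

definition radial_pucci_eq ::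
    "nat \<Rightarrow> real \<Rightarrow> real \<Rightarrow> real \<Rightarrow> real set \<Rightarrow> (real \<Rightarrow> real) \<Rightarrow> (real \<Rightarrow> real) \<Rightarrow> bool" where
  "radial_pucci_eq N \<alpha> a A I g' f \<longleftrightarrow>
     (\<exists>h. has_distributional_derivative_on I (\<lambda>r. \<bar>g' r\<bar> powr \<alpha> * g' r / (1 + \<alpha>)) h \<and>
          (AE r in lborel. r \<in> I \<longrightarrow>
             pucci_coeff a A (h r) * h r
             + pucci_coeff a A (g' r) * ((real N - 1) / r) * (\<bar>g' r\<bar> powr \<alpha> * g' r) = f r))"

text \<open>
  \<open>w\<^sup>+\<close> and \<open>w\<^sup>-\<close> are the solutions with \<open>c = 1\<close> and \<open>c = -1\<close>, unique on \<open>[0,\<infinity>)\<close>.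
\<close>

definition radial_ivp_solution ::
    "nat \<Rightarrow> real \<Rightarrow> real \<Rightarrow> real \<Rightarrow> real \<Rightarrow> (real \<Rightarrow> real) \<Rightarrow> bool" where
  "radial_ivp_solution N \<alpha> a A c w \<longleftrightarrow>
     (\<exists>w'. C1_on {0..} w w' \<and> w 0 = c \<and> w' 0 = 0 \<and>
           radial_pucci_eq N \<alpha> a A {0<..} w' (\<lambda>r. - (\<bar>w r\<bar> powr \<alpha> * w r)))"

definition increasing_positive_zeros :: "(real \<Rightarrow> real) \<Rightarrow> (nat \<Rightarrow> real) \<Rightarrow> bool" where
  "increasing_positive_zeros w \<beta> \<longleftrightarrow>
     strict_mono_on {1..} \<beta> \<and> \<beta> ` {1..} = {r. r > 0 \<and> w r = 0}"

text \<open>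
  The condition \<open>v' 0 = 0\<close> expresses that \<open>x \<mapsto> v |x|\<close> is \<open>C\<^sup>1\<close> at the origin.
\<close>

definition radial_eigenfunction ::
    "nat \<Rightarrow> real \<Rightarrow> real \<Rightarrow> real \<Rightarrow> real \<Rightarrow> (real \<Rightarrow> real) \<Rightarrow> bool" where
  "radial_eigenfunction N \<alpha> a A \<mu> v \<longleftrightarrow>
     (\<exists>r\<in>{0..1}. v r \<noteq> 0) \<and> v 1 = 0 \<and>
     (\<exists>v'. C1_on {0..1} v v' \<and> v' 0 = 0 \<and>
           (\<exists>v''. (\<forall>r\<in>{0..1}. v' r \<noteq> 0 \<longrightarrow>
                      (v' has_real_derivative v'' r) (at r within {0..1})) \<and>
                  continuous_on {r\<in>{0..1}. v' r \<noteq> 0} v'') \<and>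
           radial_pucci_eq N \<alpha> a A {0<..<1} v' (\<lambda>r. - \<mu> * (\<bar>v r\<bar> powr \<alpha> * v r)))"

definition radial_eigenvalue :: "nat \<Rightarrow> real \<Rightarrow> real \<Rightarrow> real \<Rightarrow> real \<Rightarrow> bool" where
  "radial_eigenvalue N \<alpha> a A \<mu> \<longleftrightarrow> (\<exists>v. radial_eigenfunction N \<alpha> a A \<mu> v)"

end

theory Submission
  imports Defs
begin

text \<open>
  Put \<open>p = 1 + \<alpha>\<close>, \<open>\<phi>(t) = \<bar>t\<bar>\<^sup>\<alpha> t\<close> and \<open>G(t) = \<Gamma>(t) t\<close>, and let \<open>q = \<phi>(v')\<close> be the flux of a radial function
  \<open>v\<close>. Since \<open>G\<close> is an increasing bijection, the equation with right-hand side \<open>-\<mu> \<phi>(v)\<close> determines the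
  distributional derivative of \<open>q\<close> as a function continuous in \<open>r > 0\<close>. By the lemma of du Bois-Reymond
  (\<open>distributional_derivative_continuous\<close>) the weak equation is therefore equivalent to the system of
  ordinary differential equations \<open>v' = \<phi>\<inverse>(q)\<close>, \<open>q' = p G\<inverse>(-\<mu> \<phi>(v) - ((N - 1)/r) G(q))\<close> with \<open>q(0) = 0\<close>.

  The system is positively homogeneous, and a dilation of the variable by \<open>l > 0\<close> changes \<open>\<mu> = 1\<close> into
  \<open>\<mu> = l\<^sup>p\<^sup>+\<^sup>1\<close> (\<open>solution_scale\<close>). Hence a zero \<open>l\<close> of \<open>w\<^sup>+\<close> or \<open>w\<^sup>-\<close> yields the eigenfunction \<open>w\<^sup>\<plusminus>(l r)\<close>.
  Conversely, an eigenvalue is positive, since for \<open>\<mu> \<le> 0\<close> the square of \<open>v\<close> is nondecreasing and \<open>v(1) = 0\<close>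
  (\<open>solution_nonpositive_trivial\<close>). For \<open>\<mu> > 0\<close> the initial value \<open>v(0)\<close> determines the solution
  (\<open>solution_unique\<close>), so an eigenfunction is \<open>\<bar>v(0)\<bar>\<close> times the dilation of \<open>w\<^sup>+\<close> or \<open>w\<^sup>-\<close> by the root
  \<open>l\<close> of \<open>\<mu>\<close>, according to the sign of \<open>v(0)\<close>. The boundary condition says that \<open>l\<close> is a zero of \<open>w\<^sup>\<plusminus>\<close>.
  This gives the spectrum and the simplicity of the eigenvalues at once.

  Uniqueness is the delicate point, because the system is singular at \<open>r = 0\<close> and one of \<open>\<phi>\<close>, \<open>\<phi>\<inverse>\<close> fails
  to be Lipschitz at \<open>0\<close> unless \<open>\<alpha> = 0\<close>. The singular term is decreasing in \<open>q\<close> and drops out of one-sided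
  differences (\<open>rhs_diff_le\<close>). If \<open>v\<close> and \<open>q\<close> do not both vanish at \<open>T\<close>, then both move away from zero at
  least linearly in \<open>r - T\<close> (\<open>solution_leaves_zero\<close>), and the resulting Lipschitz constants, of order
  \<open>r - T\<close> to a power above \<open>-1\<close>, are integrable (\<open>nonzero_local_uniqueness\<close>). At a common zero
  of \<open>v\<close> and \<open>q\<close> homogeneity takes over (\<open>double_zero_local\<close>).
\<close>

section \<open>Smooth cutoff functions\<close>

text \<open>
  Peeling off the first derivative, instead of applying \<open>deriv\<close> to the \<open>n\<close>-th one, turns the
  closure properties below into inductions that need only the first-order differentiation rules.
\<close>

primrec differentiable_upto :: "nat \<Rightarrow> (real \<Rightarrow> real) \<Rightarrow> bool" where
  "differentiable_upto 0 f \<longleftrightarrow> (\<forall>x. f differentiable (at x))"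
| "differentiable_upto (Suc n) f \<longleftrightarrow>
     (\<forall>x. f differentiable (at x)) \<and> differentiable_upto n (deriv f)"

definition smooth :: "(real \<Rightarrow> real) \<Rightarrow> bool" where
  "smooth f \<longleftrightarrow> (\<forall>n x. ((deriv ^^ n) f) differentiable (at x))"

lemma differentiable_upto_iff:
  "differentiable_upto n f \<longleftrightarrow> (\<forall>k\<le>n. \<forall>x. ((deriv ^^ k) f) differentiable (at x))"
proof (induction n arbitrary: f)
  case (Suc n)
  have "differentiable_upto (Suc n) f \<longleftrightarrow> (\<forall>x. f differentiable (at x)) \<and>
      (\<forall>k\<le>n. \<forall>x. ((deriv ^^ Suc k) f) differentiable (at x))"
    by (simp add: Suc.IH funpow_Suc_right del: funpow.simps)
  also have "\<dots> \<longleftrightarrow> (\<forall>k\<le>Suc n. \<forall>x. ((deriv ^^ k) f) differentiable (at x))"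
    by (metis Suc_le_mono funpow_0 not0_implies_Suc zero_le)
  finally show ?case .
qed simp

lemma smooth_iff_differentiable_upto: "smooth f \<longleftrightarrow> (\<forall>n. differentiable_upto n f)"
  by (auto simp: smooth_def differentiable_upto_iff)

lemma differentiable_upto_Suc_imp: "differentiable_upto (Suc n) f \<Longrightarrow> differentiable_upto n f"
  by (simp only: differentiable_upto_iff) auto

lemma deriv_add_fun:
  fixes f g :: "real \<Rightarrow> real"
  assumes "\<And>x. f differentiable (at x)" "\<And>x. g differentiable (at x)"
  shows "deriv (\<lambda>x. f x + g x) = (\<lambda>x. deriv f x + deriv g x)"
  using assms by (intro ext DERIV_imp_deriv derivative_eq_intros)
    (auto simp: DERIV_deriv_iff_real_differentiable)

lemma deriv_mult_fun:
  fixes f g :: "real \<Rightarrow> real"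
  assumes "\<And>x. f differentiable (at x)" "\<And>x. g differentiable (at x)"
  shows "deriv (\<lambda>x. f x * g x) = (\<lambda>x. deriv f x * g x + f x * deriv g x)"
proof
  fix x
  have "(f has_real_derivative deriv f x) (at x)" "(g has_real_derivative deriv g x) (at x)"
    using assms by (auto simp: DERIV_deriv_iff_real_differentiable)
  from DERIV_mult[OF this] show "deriv (\<lambda>x. f x * g x) x = deriv f x * g x + f x * deriv g x"
    by (intro DERIV_imp_deriv) (simp add: algebra_simps)
qed

lemma deriv_affine_fun:
  fixes f :: "real \<Rightarrow> real"
  assumes "\<And>x. f differentiable (at x)"
  shows "deriv (\<lambda>x. f (c * x + d)) = (\<lambda>x. c * deriv f (c * x + d))"
proof
  fix x
  have "(f has_real_derivative deriv f (c * x + d)) (at (c * x + d))"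
    using assms by (auto simp: DERIV_deriv_iff_real_differentiable)
  moreover have "((\<lambda>x. c * x + d) has_real_derivative c) (at x)"
    by (auto intro!: derivative_eq_intros)
  ultimately show "deriv (\<lambda>x. f (c * x + d)) x = c * deriv f (c * x + d)"
    using DERIV_chain2[of f "deriv f (c * x + d)" "\<lambda>x. c * x + d" x c UNIV]
    by (intro DERIV_imp_deriv) (simp add: mult.commute[of "deriv f (c * x + d)"])
qed

lemma differentiable_upto_add:
  "differentiable_upto n f \<Longrightarrow> differentiable_upto n g \<Longrightarrow> differentiable_upto n (\<lambda>x. f x + g x)"
  by (induction n arbitrary: f g) (auto simp: deriv_add_fun)

lemma differentiable_upto_mult:
  "differentiable_upto n f \<Longrightarrow> differentiable_upto n g \<Longrightarrow> differentiable_upto n (\<lambda>x. f x * g x)"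
proof (induction n arbitrary: f g)
  case (Suc n)
  then show ?case
    using differentiable_upto_Suc_imp[OF Suc.prems(1)] differentiable_upto_Suc_imp[OF Suc.prems(2)]
    by (auto simp: deriv_mult_fun intro!: differentiable_upto_add)
qed auto

lemma differentiable_affine_fun:
  fixes f :: "real \<Rightarrow> real"
  assumes "\<And>x. f differentiable (at x)"
  shows "(\<lambda>x. f (c * x + d)) differentiable (at x)"
  by (rule differentiable_compose[of f "\<lambda>x. c * x + d"]) (use assms in \<open>auto intro!: derivative_intros\<close>)

lemma differentiable_upto_const: "differentiable_upto n (\<lambda>x. c)"
  by (induction n arbitrary: c) (auto simp: deriv_const[abs_def])

lemma differentiable_upto_affine:
  "differentiable_upto n f \<Longrightarrow> differentiable_upto n (\<lambda>x. f (c * x + d))"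
proof (induction n arbitrary: f)
  case (Suc n)
  then show ?case
    by (auto simp: deriv_affine_fun differentiable_affine_fun
        intro!: differentiable_upto_mult differentiable_upto_const)
qed (auto intro: differentiable_affine_fun)

lemma smooth_add: "smooth f \<Longrightarrow> smooth g \<Longrightarrow> smooth (\<lambda>x. f x + g x)"
  and smooth_mult: "smooth f \<Longrightarrow> smooth g \<Longrightarrow> smooth (\<lambda>x. f x * g x)"
  and smooth_affine: "smooth f \<Longrightarrow> smooth (\<lambda>x. f (c * x + d))"
  and smooth_const: "smooth (\<lambda>x. k)"
  by (simp_all add: smooth_iff_differentiable_upto differentiable_upto_add differentiable_upto_mult
      differentiable_upto_affine differentiable_upto_const)

lemma smooth_antiderivative:
  assumes "\<And>x. (F has_real_derivative f x) (at x)" "smooth f"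
  shows "smooth F"
  unfolding smooth_iff_differentiable_upto
proof
  fix n
  have "deriv F = f"
    using assms(1) by (auto intro: DERIV_imp_deriv)
  moreover have "F differentiable (at x)" for x
    using assms(1) by (auto simp: real_differentiable_def)
  ultimately show "differentiable_upto n F"
    using assms(2) by (cases n) (auto simp: smooth_iff_differentiable_upto)
qed

text \<open>
  The functions \<open>P(1/t) exp(-1/t)\<close>, extended by zero to \<open>t \<le> 0\<close>. Differentiation maps the
  family into itself, so that one derivative settles smoothness for all orders.
\<close>

definition flat_exp :: "real poly \<Rightarrow> real \<Rightarrow> real" where
  "flat_exp p t = (if t > 0 then poly p (1 / t) * exp (- (1 / t)) else 0)"

lemma poly_over_exp_tendsto_0: "((\<lambda>x. poly p x / exp x) \<longlongrightarrow> (0::real)) at_top"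
proof -
  have "((\<lambda>x. \<Sum>i\<le>degree p. coeff p i * (x ^ i / exp x)) \<longlongrightarrow> (\<Sum>i\<le>degree p. coeff p i * 0)) at_top"
    by (intro tendsto_intros tendsto_power_div_exp_0)
  then show ?thesis
    by (simp add: poly_altdef sum_divide_distrib)
qed

text \<open>
  At \<open>t = 0\<close> the difference quotient is \<open>x P(x) / exp x\<close> with \<open>x = 1/t\<close>, which tends to zero.
\<close>

lemma flat_exp_has_derivative:
  "(flat_exp p has_real_derivative flat_exp ([:0, 0, 1:] * (p - pderiv p)) t) (at t)"
proof -
  consider "t > 0" | "t < 0" | "t = 0" by linarith
  then show ?thesis
  proof cases
    case 1
    have "((\<lambda>t. poly p (1 / t) * exp (- (1 / t))) has_real_derivative
        poly ([:0, 0, 1:] * (p - pderiv p)) (1 / t) * exp (- (1 / t))) (at t)"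
      using 1 by (auto intro!: derivative_eq_intros DERIV_chain2[OF poly_DERIV]
          simp: field_simps power2_eq_square)
    then show ?thesis
      by (rule DERIV_cong_ev[THEN iffD1, rotated 3])
        (use 1 in \<open>auto simp: flat_exp_def intro!: eventually_mono[OF eventually_gt_at_top[of 0]]
           eventually_mono[OF eventually_nhds_in_open[of "{0<..}" t]]\<close>)
  next
    case 2
    have "((\<lambda>t. 0) has_real_derivative 0) (at t)" by simp
    then show ?thesis
      by (rule DERIV_cong_ev[THEN iffD1, rotated 3])
        (use 2 in \<open>auto simp: flat_exp_def
           intro!: eventually_mono[OF eventually_nhds_in_open[of "{..<0}" t]]\<close>)
  next
    case 3
    have lim: "((\<lambda>h. poly ([:0, 1:] * p) (1 / h) / exp (1 / h)) \<longlongrightarrow> 0) (at_right (0::real))"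
      using filterlim_compose[OF poly_over_exp_tendsto_0[of "[:0, 1:] * p"] filterlim_inverse_at_top_right]
      by (simp only: inverse_eq_divide)
    have "((\<lambda>h. flat_exp p h / h) \<longlongrightarrow> 0) (at_right 0)"
      by (rule Lim_transform_eventually[OF lim])
        (auto simp: eventually_at_right_field flat_exp_def exp_minus field_simps intro!: exI[of _ 1])
    moreover have "((\<lambda>h. flat_exp p h / h) \<longlongrightarrow> 0) (at_left 0)"
      by (rule Lim_transform_eventually[OF tendsto_const])
        (auto simp: eventually_at_left_field flat_exp_def intro!: exI[of _ "-1"])
    ultimately have "((\<lambda>h. flat_exp p h / h) \<longlongrightarrow> 0) (at 0)"
      by (simp add: filterlim_split_at)
    then show ?thesis
      using 3 by (simp add: DERIV_def flat_exp_def)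
  qed
qed

lemma smooth_flat_exp: "smooth (flat_exp p)"
  unfolding smooth_iff_differentiable_upto
proof
  fix n show "differentiable_upto n (flat_exp p)"
  proof (induction n arbitrary: p)
    case (Suc n)
    then show ?case
      using flat_exp_has_derivative[of p]
      by (auto simp: real_differentiable_def DERIV_imp_deriv[OF flat_exp_has_derivative, abs_def])
  qed (use flat_exp_has_derivative in \<open>auto simp: real_differentiable_def\<close>)
qed

definition bump :: "real \<Rightarrow> real" where
  "bump t = flat_exp 1 (1 + t) * flat_exp 1 (1 - t)"

lemma smooth_bump: "smooth bump"
  using smooth_mult[OF smooth_affine[OF smooth_flat_exp, where c=1 and d=1]
      smooth_affine[OF smooth_flat_exp, where c="-1" and d=1]]
  unfolding bump_def[abs_def] by (simp add: add.commute)

lemma bump_nonneg: "bump t \<ge> 0"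
  and bump_pos: "\<bar>t\<bar> < 1 \<Longrightarrow> bump t > 0"
  and bump_eq_0: "\<bar>t\<bar> \<ge> 1 \<Longrightarrow> bump t = 0"
  by (auto simp: bump_def flat_exp_def)

lemma continuous_on_smooth: "smooth f \<Longrightarrow> continuous_on S f"
  unfolding smooth_def
  by (metis continuous_at_imp_continuous_on differentiable_imp_continuous_within funpow_0)

text \<open>
  The primitive of the bump function. Differences of its translates are test functions whose
  derivative is explicitly a difference of two bumps.
\<close>

lemma smooth_step:
  obtains H where "smooth H" "\<And>t. (H has_real_derivative bump t) (at t)"
    "\<And>t. t \<le> -1 \<Longrightarrow> H t = 0" "H 1 > 0" "\<And>t. t \<ge> 1 \<Longrightarrow> H t = H 1"
proof -
  define H where "H t = (if t \<le> -1 then 0 else integral {-1..t} bump)" for t :: real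
  have H_eq: "H t = integral {-1..t} bump" for t
    by (cases "t = -1") (auto simp: H_def)
  have deriv_H: "(H has_real_derivative bump t) (at t)" for t
  proof -
    define B where "B = \<bar>t\<bar> + 2"
    have "((\<lambda>x. integral {-B..x} bump) has_real_derivative bump t) (at t within {-B..B})"
      by (rule integral_has_real_derivative)
        (auto simp: B_def intro: continuous_on_smooth smooth_bump)
    moreover have "at t within {-B..B} = at t"
      by (rule at_within_interior) (auto simp: B_def)
    ultimately have *: "((\<lambda>x. integral {-B..x} bump) has_real_derivative bump t) (at t)"
      by simp
    have "integral {-B..x} bump = H x" if "x > -B" for x
    proof (cases "x \<le> -1")
      case True
      have "integral {-B..x} bump = integral {-B..x} (\<lambda>_. 0)"
        using True by (intro integral_cong bump_eq_0) auto
      then show ?thesis using True by (simp add: H_def)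
    next
      case False
      have "integral {-B..-1} bump + integral {-1..x} bump = integral {-B..x} bump"
        using False that by (intro Henstock_Kurzweil_Integration.integral_combine)
          (auto simp: B_def intro!: integrable_continuous_real continuous_on_smooth smooth_bump)
      moreover have "integral {-B..-1} bump = integral {-B..-1} (\<lambda>_. 0)"
        by (intro integral_cong bump_eq_0) auto
      ultimately show ?thesis by (simp add: H_eq)
    qed
    then have "\<forall>\<^sub>F x in nhds t. integral {-B..x} bump = H x"
      by (intro eventually_mono[OF eventually_nhds_in_open[of "{-B<..}" t]]) (auto simp: B_def)
    then show ?thesis
      using * by (subst DERIV_cong_ev[OF refl _ refl, of _ "\<lambda>x. integral {-B..x} bump"])
        (auto elim: eventually_mono)
  qed
  have "\<exists>z>-1. z < 1 \<and> H 1 - H (-1) = (1 - (-1)) * bump z"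
    by (rule MVT2) (use deriv_H in auto)
  then have H1: "H 1 > 0"
    using bump_pos by (auto simp: H_def abs_less_iff)
  have H_right: "H t = H 1" if t: "t \<ge> 1" for t
  proof (cases "t = 1")
    case False
    then have "\<exists>z>1. z < t \<and> H t - H 1 = (t - 1) * bump z"
      using t by (intro MVT2) (use deriv_H in auto)
    then show ?thesis using bump_eq_0 by auto
  qed simp
  have "smooth H"
    using smooth_antiderivative deriv_H smooth_bump by blast
  then show ?thesis
    by (rule that[OF _ deriv_H _ H1 H_right]) (auto simp: H_def)
qed

section \<open>Distributional derivatives of continuous functions\<close>

lemma test_function_has_derivative:
  assumes "test_function I \<psi>"
  shows "(\<psi> has_real_derivative deriv \<psi> x) (at x)"
  using assms unfolding test_function_def
  by (metis DERIV_deriv_iff_real_differentiable funpow_0)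

lemma test_function_continuous:
  assumes "test_function I \<psi>"
  shows "continuous_on S \<psi>" "continuous_on S (deriv \<psi>)"
proof -
  show "continuous_on S \<psi>"
    using test_function_has_derivative[OF assms]
    by (meson DERIV_isCont continuous_at_imp_continuous_on)
  have "(deriv \<psi>) differentiable (at x)" for x
    using assms[unfolded test_function_def] by (metis funpow_0 funpow_simps_right(2) comp_apply)
  then show "continuous_on S (deriv \<psi>)"
    by (meson continuous_at_imp_continuous_on differentiable_imp_continuous_within)
qed

text \<open>
  Integrals against a test function live on a compact interval, where Lebesgue and
  Henstock--Kurzweil integrals of continuous functions coincide and the fundamental theorem of
  calculus applies.
\<close>

lemma test_function_window:
  assumes "test_function I \<psi>" "open I" "is_interval I" "I \<noteq> {}"
  obtains p q where "p < q" "{p..q} \<subseteq> I" "\<And>x. x \<notin> {p<..<q} \<Longrightarrow> \<psi> x = 0"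
    "\<And>x. x \<notin> {p<..<q} \<Longrightarrow> deriv \<psi> x = 0"
proof -
  define K where "K = closure {x. \<psi> x \<noteq> 0}"
  have K: "compact K" "K \<subseteq> I"
    using assms(1) by (auto simp: test_function_def K_def)
  have I_Icc: "{x..y} \<subseteq> I" if "x \<in> I" "y \<in> I" for x y
    using assms(3) that unfolding is_interval_1 by (meson atLeastAtMost_iff subsetI)
  have "\<exists>p q. p < q \<and> {p..q} \<subseteq> I \<and> K \<subseteq> {p<..<q}"
  proof (cases "K = {}")
    case True
    obtain x where x: "x \<in> I" using assms(4) by auto
    then obtain e where "e > 0" "cball x e \<subseteq> I"
      using assms(2) open_contains_cball by blast
    then show ?thesis
      using True by (intro exI[of _ x] exI[of _ "x + e"])
        (auto simp: subset_iff dist_real_def)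
  next
    case False
    obtain m M where mM: "m \<in> K" "M \<in> K" "\<And>x. x \<in> K \<Longrightarrow> m \<le> x" "\<And>x. x \<in> K \<Longrightarrow> x \<le> M"
      using compact_attains_inf[OF K(1) False] compact_attains_sup[OF K(1) False] by blast
    obtain e where e: "e > 0" "cball m e \<subseteq> I"
      using assms(2) mM(1) K(2) open_contains_cball by blast
    obtain e' where e': "e' > 0" "cball M e' \<subseteq> I"
      using assms(2) mM(2) K(2) open_contains_cball by blast
    have "m - e \<in> I" "M + e' \<in> I"
      using e e' by (auto simp: subset_iff dist_real_def)
    then have "{m - e..M + e'} \<subseteq> I" by (rule I_Icc)
    moreover have "m - e < M + e'" using mM(3)[OF mM(2)] e(1) e'(1) by simp
    moreover have "K \<subseteq> {m - e<..<M + e'}"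
    proof
      fix x assume "x \<in> K"
      then show "x \<in> {m - e<..<M + e'}"
        using mM(3)[of x] mM(4)[of x] e(1) e'(1) by simp
    qed
    ultimately show ?thesis by blast
  qed
  then obtain p q where pq: "p < q" "{p..q} \<subseteq> I" "K \<subseteq> {p<..<q}" by blast
  have zero: "\<psi> x = 0" if "x \<notin> K" for x
    using that closure_subset[of "{x. \<psi> x \<noteq> 0}"] by (auto simp: K_def)
  have "deriv \<psi> x = 0" if "x \<notin> K" for x
  proof -
    have "\<forall>\<^sub>F y in nhds x. \<psi> y = 0"
      by (rule eventually_mono[OF eventually_nhds_in_open[of "- K"]])
        (use that K(1) zero in \<open>auto intro: open_Compl compact_imp_closed\<close>)
    then have "(\<psi> has_real_derivative 0) (at x)"
      by (subst DERIV_cong_ev[OF refl _ refl, of _ "\<lambda>_. 0"]) auto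
    then show ?thesis by (rule DERIV_imp_deriv)
  qed
  moreover have "x \<notin> K" if "x \<notin> {p<..<q}" for x
    using that pq(3) by blast
  ultimately show ?thesis
    using that[OF pq(1,2)] zero by presburger
qed

lemma set_integral_window:
  fixes g :: "real \<Rightarrow> real"
  assumes "{p..q} \<subseteq> I" "\<And>x. x \<notin> {p<..<q} \<Longrightarrow> g x = 0" "continuous_on {p..q} g"
  shows "(LINT x:I|lborel. g x) = integral {p..q} g"
proof -
  have "(LINT x:I|lborel. g x) = (LINT x:{p..q}|lborel. g x)"
    unfolding set_lebesgue_integral_def
    using assms(1,2) by (intro Bochner_Integration.integral_cong)
      (auto simp: indicator_def subset_iff less_eq_real_def)
  also have "\<dots> = integral {p..q} g"
    by (intro set_borel_integral_eq_integral borel_integrable_atLeastAtMost' assms)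
  finally show ?thesis .
qed

lemma integral_by_parts_vanishing:
  fixes F k \<psi> :: "real \<Rightarrow> real"
  assumes "p \<le> q" "\<And>x. x \<in> {p..q} \<Longrightarrow> (F has_real_derivative k x) (at x within {p..q})"
    "continuous_on {p..q} k"
    "\<And>x. (\<psi> has_real_derivative \<psi>' x) (at x)" "continuous_on {p..q} \<psi>'" "\<psi> p = 0" "\<psi> q = 0"
  shows "integral {p..q} (\<lambda>x. F x * \<psi>' x) = - integral {p..q} (\<lambda>x. k x * \<psi> x)"
proof -
  have cF: "continuous_on {p..q} F" and c\<psi>: "continuous_on {p..q} \<psi>"
    using DERIV_continuous_on[OF assms(2)]
      DERIV_continuous_on[OF has_field_derivative_at_within[OF assms(4)]] by blast+
  have "((\<lambda>x. k x * \<psi> x + F x * \<psi>' x) has_integral (F q * \<psi> q - F p * \<psi> p)) {p..q}"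
  proof (rule fundamental_theorem_of_calculus[OF assms(1)])
    fix x assume "x \<in> {p..q}"
    then have "((\<lambda>x. F x * \<psi> x) has_real_derivative k x * \<psi> x + F x * \<psi>' x) (at x within {p..q})"
      by (auto intro!: derivative_eq_intros assms(2) has_field_derivative_at_within[OF assms(4)])
    then show "((\<lambda>x. F x * \<psi> x) has_vector_derivative k x * \<psi> x + F x * \<psi>' x) (at x within {p..q})"
      by (simp add: has_real_derivative_iff_has_vector_derivative)
  qed
  then have "integral {p..q} (\<lambda>x. k x * \<psi> x + F x * \<psi>' x) = 0"
    using assms by (simp add: integral_unique)
  moreover have "integral {p..q} (\<lambda>x. k x * \<psi> x + F x * \<psi>' x) =
      integral {p..q} (\<lambda>x. k x * \<psi> x) + integral {p..q} (\<lambda>x. F x * \<psi>' x)"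
    by (intro Henstock_Kurzweil_Integration.integral_add integrable_continuous_real
        continuous_intros cF c\<psi> assms)
  ultimately show ?thesis by simp
qed

lemma continuous_imp_locally_integrable:
  "continuous_on I f \<Longrightarrow> locally_integrable_on I f"
  unfolding locally_integrable_on_def
  by (metis borel_integrable_compact continuous_on_subset set_integrable_def)

lemma derivative_imp_distributional_derivative:
  assumes I: "open I" "is_interval I"
    and F: "\<And>x. x \<in> I \<Longrightarrow> (F has_real_derivative k x) (at x)" and k: "continuous_on I k"
  shows "has_distributional_derivative_on I F k"
  unfolding has_distributional_derivative_on_def
proof (intro conjI allI impI)
  have cF: "continuous_on I F"
    using F by (meson DERIV_isCont continuous_at_imp_continuous_on)
  show "locally_integrable_on I F" "locally_integrable_on I k"
    using cF k by (auto intro: continuous_imp_locally_integrable)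
  fix \<psi> assume \<psi>: "test_function I \<psi>"
  note c\<psi> = test_function_continuous[OF \<psi>]
  show "(LINT x:I|lborel. F x * deriv \<psi> x) = - (LINT x:I|lborel. k x * \<psi> x)"
  proof (cases "I = {}")
    case False
    from test_function_window[OF \<psi> I False] obtain p q
      where pq: "p < q" "{p..q} \<subseteq> I" "\<And>x. x \<notin> {p<..<q} \<Longrightarrow> \<psi> x = 0"
        "\<And>x. x \<notin> {p<..<q} \<Longrightarrow> deriv \<psi> x = 0" by metis
    have F': "continuous_on {p..q} F" and k': "continuous_on {p..q} k"
      using cF k pq(2) continuous_on_subset by blast+
    have "(LINT x:I|lborel. F x * deriv \<psi> x) = integral {p..q} (\<lambda>x. F x * deriv \<psi> x)"
      by (rule set_integral_window[OF pq(2)]) (simp add: pq(4), intro continuous_intros c\<psi> F')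
    also have "\<dots> = - integral {p..q} (\<lambda>x. k x * \<psi> x)"
    proof (rule integral_by_parts_vanishing)
      show "(F has_real_derivative k x) (at x within {p..q})" if "x \<in> {p..q}" for x
        using F pq(2) that by (blast intro: has_field_derivative_at_within)
      show "\<psi> p = 0" "\<psi> q = 0" by (simp_all add: pq(3))
    qed (use pq(1) in \<open>simp_all add: k' c\<psi> test_function_has_derivative[OF \<psi>]\<close>)
    also have "integral {p..q} (\<lambda>x. k x * \<psi> x) = (LINT x:I|lborel. k x * \<psi> x)"
      by (rule set_integral_window[OF pq(2), symmetric])
        (simp add: pq(3), intro continuous_intros c\<psi> k')
    finally show ?thesis .
  qed (simp add: set_lebesgue_integral_def)
qed

text \<open>
  A continuous representative \<open>k\<close> of the distributional derivative may be tested in its place,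
  now as an ordinary integral over a compact interval.
\<close>

lemma distributional_derivative_tested:
  assumes dd: "has_distributional_derivative_on I f h" and \<psi>: "test_function I \<psi>"
    and pq: "{p..q} \<subseteq> I" "\<And>x. x \<notin> {p<..<q} \<Longrightarrow> \<psi> x = 0" "\<And>x. x \<notin> {p<..<q} \<Longrightarrow> deriv \<psi> x = 0"
    and f: "continuous_on {p..q} f" and k: "continuous_on {p..q} k"
    and AE: "AE x in lborel. x \<in> I \<longrightarrow> h x = k x"
  shows "integral {p..q} (\<lambda>x. f x * deriv \<psi> x) = - integral {p..q} (\<lambda>x. k x * \<psi> x)"
proof -
  note c\<psi> = test_function_continuous[OF \<psi>]
  have m: "(\<lambda>x. indicator {p..q} x * h x) \<in> borel_measurable borel"
    "(\<lambda>x. indicator {p..q} x * k x) \<in> borel_measurable borel"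
  proof -
    have "set_integrable lborel {p..q} h"
      using dd pq(1) compact_Icc
      unfolding has_distributional_derivative_on_def locally_integrable_on_def by blast
    from borel_measurable_integrable[OF this[unfolded set_integrable_def]]
    show "(\<lambda>x. indicator {p..q} x * h x) \<in> borel_measurable borel" by simp
    from borel_measurable_integrable[OF borel_integrable_atLeastAtMost'[OF k, unfolded set_integrable_def]]
    show "(\<lambda>x. indicator {p..q} x * k x) \<in> borel_measurable borel" by simp
  qed
  have m\<psi>: "\<psi> \<in> borel_measurable borel"
    by (intro borel_measurable_continuous_onI c\<psi>)
  have eq: "indicat_real I x *\<^sub>R (g x * \<psi> x) = (indicator {p..q} x * g x) * \<psi> x" for g x
    using pq(1) pq(2)[of x] by (auto simp: indicator_def)
  have "integral {p..q} (\<lambda>x. f x * deriv \<psi> x) = (LINT x:I|lborel. f x * deriv \<psi> x)"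
    by (rule set_integral_window[OF pq(1), symmetric])
      (simp add: pq(3), intro continuous_intros c\<psi> f)
  also have "\<dots> = - (LINT x:I|lborel. h x * \<psi> x)"
    using dd \<psi> by (auto simp: has_distributional_derivative_on_def)
  also have "(LINT x:I|lborel. h x * \<psi> x) = (LINT x:I|lborel. k x * \<psi> x)"
    unfolding set_lebesgue_integral_def eq
  proof (rule integral_cong_AE)
    show "AE x in lborel. indicat_real {p..q} x * h x * \<psi> x = indicat_real {p..q} x * k x * \<psi> x"
      using AE by eventually_elim (use pq(1) in \<open>auto simp: indicator_def\<close>)
  qed (use m m\<psi> in auto)
  also have "\<dots> = integral {p..q} (\<lambda>x. k x * \<psi> x)"
    by (rule set_integral_window[OF pq(1)]) (simp add: pq(2), intro continuous_intros c\<psi> k)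
  finally show ?thesis .
qed

text \<open>
  A plateau between \<open>x\<close> and \<open>y\<close>: its derivative is an approximate point mass at \<open>x\<close> minus one of the
  same mass \<open>H\<close> at \<open>y\<close>.
\<close>

lemma test_function_transition:
  fixes x y \<delta> :: real
  assumes \<delta>: "\<delta> > 0" and xy: "x < y"
  obtains H \<psi> where
    "H > 0" "\<And>I. {x - \<delta>..y + \<delta>} \<subseteq> I \<Longrightarrow> test_function I \<psi>"
    "\<And>t. t \<notin> {x - \<delta><..<y + \<delta>} \<Longrightarrow> \<psi> t = 0"
    "\<And>t. deriv \<psi> t = bump ((t - x) / \<delta>) / \<delta> - bump ((t - y) / \<delta>) / \<delta>"
    "\<And>z p q. p \<le> z - \<delta> \<Longrightarrow> z + \<delta> \<le> q \<Longrightarrow> ((\<lambda>t. bump ((t - z) / \<delta>) / \<delta>) has_integral H) {p..q}"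
proof -
  obtain H where H: "smooth H" "\<And>t. (H has_real_derivative bump t) (at t)"
    "\<And>t. t \<le> -1 \<Longrightarrow> H t = 0" "H 1 > 0" "\<And>t. t \<ge> 1 \<Longrightarrow> H t = H 1"
    using smooth_step by blast
  define h where "h z t = H ((t - z) / \<delta>)" for z t
  define \<psi> where "\<psi> t = h x t + (-1) * h y t" for t
  have d: "(h z has_real_derivative bump ((t - z) / \<delta>) / \<delta>) (at t)" for z t
    unfolding h_def[abs_def]
    by (rule DERIV_cong[OF DERIV_chain2[OF H(2)]]) (use \<delta> in \<open>auto intro!: derivative_eq_intros\<close>)
  have "smooth (h z)" for z
    using smooth_affine[OF H(1), where c="1/\<delta>" and d="-z/\<delta>"] unfolding h_def[abs_def]
    by (simp add: diff_divide_distrib)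
  then have "smooth \<psi>"
    unfolding \<psi>_def[abs_def] by (intro smooth_add smooth_mult smooth_const)
  moreover have zero: "\<psi> t = 0" if t: "t \<notin> {x - \<delta><..<y + \<delta>}" for t
  proof -
    consider "t \<le> x - \<delta>" | "t \<ge> y + \<delta>"
      using t by fastforce
    then show ?thesis
    proof cases
      case 1
      then have "(t - x) / \<delta> \<le> -1" "(t - y) / \<delta> \<le> -1"
        using \<delta> xy by (auto simp: field_simps)
      then have "h x t = 0" "h y t = 0" unfolding h_def using H(3) by blast+
      then show ?thesis by (simp add: \<psi>_def)
    next
      case 2
      then have "(t - x) / \<delta> \<ge> 1" "(t - y) / \<delta> \<ge> 1"
        using \<delta> xy by (auto simp: field_simps)
      then have "h x t = H 1" "h y t = H 1" unfolding h_def using H(5) by blast+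
      then show ?thesis by (simp add: \<psi>_def)
    qed
  qed
  moreover have sub: "closure {t. \<psi> t \<noteq> 0} \<subseteq> {x - \<delta>..y + \<delta>}"
  proof (rule closure_minimal)
    have "{t. \<psi> t \<noteq> 0} \<subseteq> {x - \<delta><..<y + \<delta>}"
      using zero by blast
    then show "{t. \<psi> t \<noteq> 0} \<subseteq> {x - \<delta>..y + \<delta>}"
      using greaterThanLessThan_subseteq_atLeastAtMost_iff by (blast intro: less_imp_le)
  qed simp
  moreover have "compact (closure {t. \<psi> t \<noteq> 0})"
    using compact_Int_closed[OF compact_Icc closed_closure, of "x - \<delta>" "y + \<delta>" "{t. \<psi> t \<noteq> 0}"] sub
    by (simp add: inf.absorb2)
  ultimately have test: "test_function I \<psi>" if "{x - \<delta>..y + \<delta>} \<subseteq> I" for I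
    using that by (auto simp: test_function_def smooth_def)
  have deriv: "deriv \<psi> t = bump ((t - x) / \<delta>) / \<delta> - bump ((t - y) / \<delta>) / \<delta>" for t
    unfolding \<psi>_def[abs_def]
    by (rule DERIV_imp_deriv[OF DERIV_cong[OF DERIV_add[OF d DERIV_cmult[OF d]]]]) simp
  have int: "((\<lambda>t. bump ((t - z) / \<delta>) / \<delta>) has_integral H 1) {p..q}"
    if "p \<le> z - \<delta>" "z + \<delta> \<le> q" for z p q
  proof -
    have "((\<lambda>t. bump ((t - z) / \<delta>) / \<delta>) has_integral (h z q - h z p)) {p..q}"
    proof (rule fundamental_theorem_of_calculus)
      show "(h z has_vector_derivative bump ((t - z) / \<delta>) / \<delta>) (at t within {p..q})" for t
        using d[of z t]
        by (simp add: has_real_derivative_iff_has_vector_derivative has_vector_derivative_at_within)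
    qed (use that \<delta> in simp)
    moreover have "(q - z) / \<delta> \<ge> 1" "(p - z) / \<delta> \<le> -1"
      using that \<delta> by (auto simp: field_simps)
    then have "h z q = H 1" "h z p = 0"
      unfolding h_def using H(3,5) by blast+
    ultimately show ?thesis by simp
  qed
  show ?thesis
    by (rule that[OF H(4) test zero deriv int])
qed

lemma integral_near_point:
  fixes u b :: "real \<Rightarrow> real"
  assumes b: "(b has_integral H) {p..q}" "\<And>t. b t \<ge> 0"
    and ub: "((\<lambda>t. u t * b t) has_integral J) {p..q}"
    and near: "\<And>t. t \<in> {p..q} \<Longrightarrow> b t \<noteq> 0 \<Longrightarrow> \<bar>u t - c\<bar> \<le> e"
  shows "\<bar>J - c * H\<bar> \<le> e * H"
proof -
  have "u t * b t \<le> (c + e) * b t \<and> (c - e) * b t \<le> u t * b t" if "t \<in> {p..q}" for t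
    using near[OF that] b(2)[of t] by (cases "b t = 0") (auto intro!: mult_right_mono)
  then have "J \<le> (c + e) * H" "(c - e) * H \<le> J"
    by (auto intro!: has_integral_le[OF ub] has_integral_le[OF _ ub] has_integral_mult_right b)
  then show ?thesis by (simp add: abs_le_iff algebra_simps)
qed

text \<open>
  Testing with a plateau between \<open>x\<close> and \<open>y\<close> shows that \<open>u\<close> has equal weighted means over the
  \<open>\<delta>\<close>-neighbourhoods of both points; by continuity these means are within \<open>e\<close> of \<open>u x\<close> and \<open>u y\<close>.
\<close>

lemma weakly_constant_imp_eq:
  fixes u :: "real \<Rightarrow> real"
  assumes u: "continuous_on {p..q} u" and xy: "p < x" "x < y" "y < q"
    and weak: "\<And>\<psi>. test_function {p<..<q} \<psi> \<Longrightarrow> integral {p..q} (\<lambda>t. u t * deriv \<psi> t) = 0"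
  shows "u x = u y"
proof -
  have "\<bar>u x - u y\<bar> \<le> 2 * e" if e: "e > 0" for e
  proof -
    have ex: "\<exists>d>0. \<forall>t\<in>{p..q}. \<bar>t - z\<bar> < d \<longrightarrow> \<bar>u t - u z\<bar> \<le> e" if "z \<in> {p..q}" for z
      using u that e unfolding continuous_on_iff dist_real_def by (meson less_imp_le)
    obtain dx where dx: "dx > 0" "\<And>t. t \<in> {p..q} \<Longrightarrow> \<bar>t - x\<bar> < dx \<Longrightarrow> \<bar>u t - u x\<bar> \<le> e"
      using ex[of x] xy by force
    obtain dy where dy: "dy > 0" "\<And>t. t \<in> {p..q} \<Longrightarrow> \<bar>t - y\<bar> < dy \<Longrightarrow> \<bar>u t - u y\<bar> \<le> e"
      using ex[of y] xy by force
    define \<delta> where "\<delta> = Min {dx, dy, (x - p) / 2, (q - y) / 2}"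
    have \<delta>: "\<delta> > 0" "\<delta> \<le> dx" "\<delta> \<le> dy" "\<delta> \<le> (x - p) / 2" "\<delta> \<le> (q - y) / 2"
      proof -
      show "\<delta> > 0" using dx(1) dy(1) xy by (auto simp: \<delta>_def)
      show "\<delta> \<le> dx" "\<delta> \<le> dy" "\<delta> \<le> (x - p) / 2" "\<delta> \<le> (q - y) / 2"
        unfolding \<delta>_def by (rule Min_le; simp)+
    qed
    obtain H \<psi> where H: "H > 0" "\<And>I. {x - \<delta>..y + \<delta>} \<subseteq> I \<Longrightarrow> test_function I \<psi>"
      "\<And>t. t \<notin> {x - \<delta><..<y + \<delta>} \<Longrightarrow> \<psi> t = 0"
      "\<And>t. deriv \<psi> t = bump ((t - x) / \<delta>) / \<delta> - bump ((t - y) / \<delta>) / \<delta>"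
      "\<And>z p q. p \<le> z - \<delta> \<Longrightarrow> z + \<delta> \<le> q \<Longrightarrow> ((\<lambda>t. bump ((t - z) / \<delta>) / \<delta>) has_integral H) {p..q}"
      using test_function_transition[OF \<delta>(1) xy(2)] by blast
    define J where "J z = integral {p..q} (\<lambda>t. u t * (bump ((t - z) / \<delta>) / \<delta>))" for z
    have J: "((\<lambda>t. u t * (bump ((t - z) / \<delta>) / \<delta>)) has_integral J z) {p..q}" for z
      unfolding J_def using \<delta>(1)
      by (intro integrable_integral integrable_continuous_real continuous_intros u
          continuous_on_compose2[OF continuous_on_smooth[OF smooth_bump, of UNIV]]) auto
    have "integral {p..q} (\<lambda>t. u t * deriv \<psi> t) = 0"
      using \<delta> xy by (intro weak H(2)) auto
    moreover have "((\<lambda>t. u t * deriv \<psi> t) has_integral (J x - J y)) {p..q}"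
      using has_integral_diff[OF J[of x] J[of y]] by (simp add: H(4) algebra_simps)
    ultimately have "J x = J y"
      by (simp add: integral_unique)
    moreover have close: "\<bar>J z - u z * H\<bar> \<le> e * H"
      if "p \<le> z - \<delta>" "z + \<delta> \<le> q" "\<And>t. t \<in> {p..q} \<Longrightarrow> \<bar>t - z\<bar> < \<delta> \<Longrightarrow> \<bar>u t - u z\<bar> \<le> e" for z
    proof (rule integral_near_point[OF H(5)[OF that(1,2)] _ J])
      show "bump ((t - z) / \<delta>) / \<delta> \<ge> 0" for t
        using bump_nonneg \<delta>(1) by simp
      show "\<bar>u t - u z\<bar> \<le> e" if "t \<in> {p..q}" "bump ((t - z) / \<delta>) / \<delta> \<noteq> 0" for t
      proof -
        have "\<not> \<bar>(t - z) / \<delta>\<bar> \<ge> 1"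
          using that bump_eq_0 by force
        then have "\<bar>t - z\<bar> < \<delta>"
          using \<delta>(1) by (simp add: abs_divide)
        then show ?thesis using \<open>\<And>t. t \<in> {p..q} \<Longrightarrow> \<bar>t - z\<bar> < \<delta> \<Longrightarrow> \<bar>u t - u z\<bar> \<le> e\<close> that by blast
      qed
    qed
    have "\<bar>J x - u x * H\<bar> \<le> e * H" "\<bar>J y - u y * H\<bar> \<le> e * H"
      by (rule close; use \<delta> xy dx dy in force)+
    ultimately have "\<bar>(u x - u y) * H\<bar> \<le> (2 * e) * H"
      by (simp add: algebra_simps)
    then show ?thesis using H(1) by (simp add: abs_mult)
  qed
  from this[of "\<bar>u x - u y\<bar> / 4"] show ?thesis by fastforce
qed

text \<open>
  The lemma of du Bois-Reymond: subtracting a primitive of \<open>k\<close> from \<open>f\<close> leaves a continuous function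
  with vanishing distributional derivative, which is constant.
\<close>

lemma distributional_derivative_continuous:
  assumes I: "open I" "is_interval I"
    and dd: "has_distributional_derivative_on I f h"
    and f: "continuous_on I f" and k: "continuous_on I k"
    and AE: "AE x in lborel. x \<in> I \<longrightarrow> h x = k x" and r: "r \<in> I"
  shows "(f has_real_derivative k r) (at r)"
proof -
  obtain e where e: "e > 0" "cball r e \<subseteq> I"
    using I(1) r open_contains_cball by blast
  define p q where "p = r - e" and "q = r + e"
  have pq: "p < r" "r < q" "{p..q} \<subseteq> I"
    using e by (auto simp: p_def q_def subset_iff dist_real_def abs_le_iff)
  have f': "continuous_on {p..q} f" and k': "continuous_on {p..q} k"
    using f k pq(3) by (auto intro: continuous_on_subset)
  define K where "K t = integral {p..t} k" for t
  have K: "(K has_real_derivative k t) (at t within {p..q})" if "t \<in> {p..q}" for t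
    unfolding K_def[abs_def] by (rule integral_has_real_derivative[OF k' that])
  then have cK: "continuous_on {p..q} K"
    by (rule DERIV_continuous_on)
  define u where "u t = f t - K t" for t
  have u: "continuous_on {p..q} u"
    unfolding u_def by (intro continuous_intros f' cK)
  have weak: "integral {p..q} (\<lambda>t. u t * deriv \<psi> t) = 0" if \<psi>: "test_function {p<..<q} \<psi>" for \<psi>
  proof -
    have "test_function I \<psi>"
      using \<psi> pq(3) unfolding test_function_def by fastforce
    note c\<psi> = test_function_continuous[OF this]
    have "p < q" using pq by simp
    then obtain p' q' where pq': "{p'..q'} \<subseteq> {p<..<q}" "\<And>x. x \<notin> {p'<..<q'} \<Longrightarrow> \<psi> x = 0"
        "\<And>x. x \<notin> {p'<..<q'} \<Longrightarrow> deriv \<psi> x = 0" "p' < q'"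
      using test_function_window[OF \<psi>] by (metis greaterThanLessThan_empty_iff is_interval_oo
          leD open_greaterThanLessThan)
    have zero: "\<psi> x = 0" "deriv \<psi> x = 0" if "x \<notin> {p<..<q}" for x
      using that pq' by (metis atLeastAtMost_iff greaterThanLessThan_iff less_imp_le subset_iff)+
    have "integral {p..q} (\<lambda>t. f t * deriv \<psi> t) = - integral {p..q} (\<lambda>t. k t * \<psi> t)"
      by (rule distributional_derivative_tested[OF dd \<open>test_function I \<psi>\<close> pq(3) zero f' k' AE])
    moreover have "integral {p..q} (\<lambda>t. K t * deriv \<psi> t) = - integral {p..q} (\<lambda>t. k t * \<psi> t)"
      using pq zero by (intro integral_by_parts_vanishing K k' c\<psi>
          test_function_has_derivative[OF \<psi>]) auto
    moreover have "integral {p..q} (\<lambda>t. u t * deriv \<psi> t) =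
        integral {p..q} (\<lambda>t. f t * deriv \<psi> t) - integral {p..q} (\<lambda>t. K t * deriv \<psi> t)"
      unfolding u_def left_diff_distrib
      by (intro Henstock_Kurzweil_Integration.integral_diff integrable_continuous_real
          continuous_intros f' cK c\<psi>)
    ultimately show ?thesis by simp
  qed
  have const: "u t = u r" if "t \<in> {p<..<q}" for t
  proof (cases t r rule: linorder_cases)
    case less
    then show ?thesis using weakly_constant_imp_eq[OF u _ _ _ weak, of t r] that pq by auto
  next
    case greater
    then show ?thesis using weakly_constant_imp_eq[OF u _ _ _ weak, of r t] that pq by auto
  qed auto
  have "(K has_real_derivative k r) (at r)"
    using K[of r] pq by (simp add: at_within_Icc_at)
  then have "((\<lambda>t. u r + K t) has_real_derivative k r) (at r)"
    by (auto intro!: derivative_eq_intros)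
  moreover have "\<forall>\<^sub>F t in nhds r. u r + K t = f t"
  proof (rule eventually_mono[OF eventually_nhds_in_open[of "{p<..<q}" r]])
    show "u r + K t = f t" if "t \<in> {p<..<q}" for t
      using const[OF that] unfolding u_def by linarith
  qed (use pq in auto)
  ultimately show ?thesis
    by (subst DERIV_cong_ev[OF refl _ refl, of _ "\<lambda>t. u r + K t"]) (auto elim: eventually_mono)
qed

section \<open>Odd powers\<close>

text \<open>
  The odd power \<open>\<bar>x\<bar>\<^sup>p sgn x\<close>. With \<open>p = 1 + \<alpha>\<close> it is the nonlinearity \<open>\<bar>x\<bar>\<^sup>\<alpha> x\<close>, and its inverse function
  is the odd power with exponent \<open>1/p\<close>, so that one set of lemmas serves both.
\<close>

definition spow :: "real \<Rightarrow> real \<Rightarrow> real" where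
  "spow p x = sgn x * \<bar>x\<bar> powr p"

lemma spow_0 [simp]: "spow p 0 = 0"
  and spow_pos: "x > 0 \<Longrightarrow> spow p x = x powr p"
  and spow_minus: "spow p (- x) = - spow p x"
  and sgn_spow [simp]: "sgn (spow p x) = sgn x"
  and abs_spow: "\<bar>spow p x\<bar> = \<bar>x\<bar> powr p"
  by (auto simp: spow_def sgn_if abs_mult)

lemma spow_eq_0_iff [simp]: "spow p x = 0 \<longleftrightarrow> x = 0"
  by (auto simp: spow_def sgn_if)

lemma powr_abs_mult_eq_spow: "\<bar>x\<bar> powr \<alpha> * x = spow (1 + \<alpha>) x"
  by (cases "x = 0") (auto simp: spow_def powr_add sgn_if abs_if)

lemma spow_mult:
  assumes "c \<ge> 0"
  shows "spow p (c * x) = c powr p * spow p x"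
  using assms by (cases "c = 0") (auto simp: spow_def sgn_mult abs_mult powr_mult)

lemma spow_sign_mult: "\<bar>\<sigma>\<bar> = 1 \<Longrightarrow> spow p (\<sigma> * x) = \<sigma> * spow p x"
  by (auto simp: abs_if spow_minus split: if_splits)

lemma spow_inverse:
  assumes "p \<noteq> 0"
  shows "spow (1 / p) (spow p x) = x"
proof -
  have "spow (1 / p) (spow p x) = sgn x * \<bar>spow p x\<bar> powr (1 / p)"
    using sgn_spow[of p x] by (simp only: spow_def[of "1 / p"])
  then show ?thesis
    using assms by (simp add: abs_spow powr_powr sgn_mult_abs)
qed

lemma continuous_spow: "p > 0 \<Longrightarrow> continuous_on S (spow p)"
proof -
  assume p: "p > 0"
  have "spow p x = max x 0 powr p - max (- x) 0 powr p" for x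
    by (auto simp: spow_def sgn_if max_def)
  then have "spow p = (\<lambda>x. max x 0 powr p - max (- x) 0 powr p)" by auto
  moreover have "continuous_on S (\<lambda>x::real. max x 0 powr p - max (- x) 0 powr p)"
    using p by (intro continuous_intros continuous_on_powr') auto
  ultimately show ?thesis by simp
qed

lemma continuous_on_spow:
  "p > 0 \<Longrightarrow> continuous_on S f \<Longrightarrow> continuous_on S (\<lambda>x. spow p (f x))"
  by (rule continuous_on_compose2[OF continuous_spow[of p UNIV]]) auto

lemma spow_mono:
  assumes "p > 0" "x \<le> y"
  shows "spow p x \<le> spow p y"
  using assms by (auto simp: spow_def sgn_if intro: powr_mono2 order_trans[of _ 0])

lemma spow_ge:
  assumes "p > 0" "0 < m" "m \<le> x"
  shows "m powr p \<le> spow p x"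
  using spow_mono[OF assms(1,3)] spow_pos[OF assms(2)] by simp

lemma spow_has_derivative:
  assumes "x \<noteq> 0"
  shows "(spow p has_real_derivative p * \<bar>x\<bar> powr (p - 1)) (at x)"
proof (cases "x > 0")
  case True
  have "((\<lambda>x. x powr p) has_real_derivative p * x powr (p - 1)) (at x)"
    using True by (auto intro!: derivative_eq_intros)
  moreover have "\<forall>\<^sub>F y in nhds x. y powr p = spow p y"
    using True by (intro eventually_mono[OF eventually_nhds_in_open[of "{0<..}" x]])
      (auto simp: spow_pos)
  ultimately show ?thesis
    using True by (subst (asm) DERIV_cong_ev) auto
next
  case False
  then have x: "x < 0" using assms by simp
  have "((\<lambda>x. - ((- x) powr p)) has_real_derivative p * (- x) powr (p - 1)) (at x)"
    using x by (auto intro!: derivative_eq_intros)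
  moreover have "\<forall>\<^sub>F y in nhds x. - ((- y) powr p) = spow p y"
    using x by (intro eventually_mono[OF eventually_nhds_in_open[of "{..<0}" x]])
      (auto simp: spow_def)
  ultimately show ?thesis
    using x by (subst (asm) DERIV_cong_ev) auto
qed

text \<open>
  Odd powers with exponent below one are not Lipschitz at the origin. On arguments of one sign that
  are at least \<open>c s\<close> in absolute value, the mean value theorem still gives a constant of order \<open>s\<close> to
  the power \<open>\<kappa> - 1\<close>, and this is integrable at \<open>s = 0\<close> as long as \<open>\<kappa> > 0\<close>.
\<close>

lemma spow_lipschitz_away:
  assumes "p > 0" "c > 0" "\<kappa> \<le> 1" "\<kappa> \<le> p"
  obtains K where "K \<ge> 0"
    "\<And>\<sigma> s x y. \<bar>\<sigma>\<bar> = 1 \<Longrightarrow> 0 < s \<Longrightarrow> s \<le> 1 \<Longrightarrow> c * s \<le> \<sigma> * x \<Longrightarrow> c * s \<le> \<sigma> * y \<Longrightarrow> \<bar>x\<bar> \<le> M \<Longrightarrow> \<bar>y\<bar> \<le> M \<Longrightarrow>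
      \<bar>spow p x - spow p y\<bar> \<le> K * s powr (\<kappa> - 1) * \<bar>x - y\<bar>"
proof -
  define B where "B = M powr (p - 1) + c powr (p - 1)"
  have key: "z powr (p - 1) \<le> B * s powr (\<kappa> - 1)" if "0 < s" "s \<le> 1" "c * s \<le> z" "z \<le> M" for s z
  proof (cases "p \<ge> 1")
    case True
    have z: "z > 0" using that assms(2) by (smt (verit) mult_pos_pos)
    have "1 \<le> s powr (\<kappa> - 1)"
      using powr_mono'[of "\<kappa> - 1" 0 s] that assms(3) by simp
    then have "B * 1 \<le> B * s powr (\<kappa> - 1)"
      by (intro mult_left_mono) (auto simp: B_def)
    moreover have "z powr (p - 1) \<le> M powr (p - 1)"
      using z that True by (intro powr_mono2) auto
    ultimately show ?thesis by (simp add: B_def) (smt (verit) powr_ge_zero)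
  next
    case False
    have "z powr (p - 1) \<le> (c * s) powr (p - 1)"
      using False that assms(2) by (intro powr_mono2') auto
    also have "\<dots> = c powr (p - 1) * s powr (p - 1)"
      using assms(2) that by (simp add: powr_mult)
    also have "\<dots> \<le> B * s powr (\<kappa> - 1)"
      using assms that by (intro mult_mono powr_mono') (auto simp: B_def)
    finally show ?thesis .
  qed
  have pos_less: "\<bar>spow p x - spow p y\<bar> \<le> p * B * s powr (\<kappa> - 1) * \<bar>x - y\<bar>"
    if s: "0 < s" "s \<le> 1" "c * s \<le> x" "y \<le> M" and xy: "x < y" for s x y
  proof -
    have x: "x > 0" using s assms(2) by (smt (verit) mult_pos_pos)
    have "\<exists>z>x. z < y \<and> spow p y - spow p x = (y - x) * (p * \<bar>z\<bar> powr (p - 1))"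
      using xy x by (intro MVT2 spow_has_derivative) auto
    then obtain z where z: "x < z" "z < y" "spow p y - spow p x = (y - x) * (p * \<bar>z\<bar> powr (p - 1))"
      by blast
    have "\<bar>spow p x - spow p y\<bar> = (y - x) * (p * z powr (p - 1))"
      using z x xy assms(1) by (subst abs_minus_commute) (simp add: abs_mult)
    also have "\<dots> \<le> (y - x) * (p * (B * s powr (\<kappa> - 1)))"
      using key[of s z] s z xy assms(1) by (intro mult_left_mono) auto
    finally show ?thesis using xy by (simp add: algebra_simps)
  qed
  have pos: "\<bar>spow p x - spow p y\<bar> \<le> p * B * s powr (\<kappa> - 1) * \<bar>x - y\<bar>"
    if "0 < s" "s \<le> 1" "c * s \<le> x" "c * s \<le> y" "x \<le> M" "y \<le> M" for s x y
    using pos_less[of s x y] pos_less[of s y x] that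
    by (cases x y rule: linorder_cases) (auto simp: abs_minus_commute)
  show ?thesis
  proof (rule that[of "p * B"])
    show "p * B \<ge> 0" using assms(1) by (simp add: B_def)
    fix \<sigma> s x y :: real
    assume \<sigma>: "\<bar>\<sigma>\<bar> = 1" and h: "0 < s" "s \<le> 1" "c * s \<le> \<sigma> * x" "c * s \<le> \<sigma> * y" "\<bar>x\<bar> \<le> M" "\<bar>y\<bar> \<le> M"
    have "\<bar>spow p (\<sigma> * x) - spow p (\<sigma> * y)\<bar> \<le> p * B * s powr (\<kappa> - 1) * \<bar>\<sigma> * x - \<sigma> * y\<bar>"
      using \<sigma> h by (intro pos) (auto simp: abs_if split: if_splits)
    then show "\<bar>spow p x - spow p y\<bar> \<le> p * B * s powr (\<kappa> - 1) * \<bar>x - y\<bar>"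
      using \<sigma> by (simp add: spow_sign_mult right_diff_distrib[symmetric] abs_mult)
  qed
qed

section \<open>A comparison principle\<close>

text \<open>
  The derivatives have to be compared only where the conclusion fails: after the last point at which
  \<open>f \<le> g\<close> holds, the difference \<open>f - g\<close> would be positive and nonincreasing. This is what
  lets the one-sided monotonicity of the equation in the flux be exploited.
\<close>

lemma derivative_comparison:
  fixes f g :: "real \<Rightarrow> real"
  assumes f: "continuous_on {T..b} f" and g: "continuous_on {T..b} g" and init: "f T \<le> g T"
    and cross: "\<And>x. T < x \<Longrightarrow> x < b \<Longrightarrow> g x < f x \<Longrightarrow>
      \<exists>f' g'. (f has_real_derivative f') (at x) \<and> (g has_real_derivative g') (at x) \<and> f' \<le> g'"
    and x: "x \<in> {T..b}"
  shows "f x \<le> g x"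
proof (rule ccontr)
  assume nle: "\<not> f x \<le> g x"
  define z where "z t = f t - g t" for t
  have cz: "continuous_on {T..x} z"
    unfolding z_def using x by (intro continuous_intros continuous_on_subset[OF f] continuous_on_subset[OF g]) auto
  define S where "S = {t \<in> {T..x}. z t \<le> 0}"
  have "S = {T..x} \<inter> z -` {..0}" by (auto simp: S_def)
  then have "closed S"
    using continuous_closed_preimage[OF cz closed_atLeastAtMost closed_atMost] by simp
  moreover have "bounded S"
    by (rule bounded_subset[OF bounded_closed_interval[of T x]]) (auto simp: S_def)
  ultimately have "compact S"
    by (simp add: compact_eq_bounded_closed)
  moreover have "T \<in> S" using init x by (simp add: S_def z_def)
  then have "S \<noteq> {}" by blast
  ultimately obtain t0 where t0: "t0 \<in> S" "\<And>t. t \<in> S \<Longrightarrow> t \<le> t0"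
    using compact_attains_sup[of S] by blast
  have "t0 \<noteq> x" using t0(1) nle by (auto simp: S_def z_def)
  then have "t0 < x" using t0(1) by (simp add: S_def)
  have pos: "z t > 0" if "t0 < t" "t \<le> x" for t
  proof (rule ccontr)
    assume "\<not> z t > 0"
    then have "t \<in> S" using t0(1) that by (simp add: S_def)
    then show False using t0(2) that(1) by force
  qed
  have deriv: "\<exists>d\<le>0. (z has_real_derivative d) (at t)" if t: "t0 < t" "t < x" for t
  proof -
    have "T < t" "t < b" using t x t0(1) by (auto simp: S_def)
    then obtain f' g' where "(f has_real_derivative f') (at t)" "(g has_real_derivative g') (at t)" "f' \<le> g'"
      using cross[of t] pos[of t] t by (auto simp: z_def)
    then show ?thesis
      unfolding z_def[abs_def] by (intro exI[of _ "f' - g'"]) (auto intro!: derivative_eq_intros)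
  qed
  have "\<exists>l u. t0 < u \<and> u < x \<and> (z has_real_derivative l) (at u) \<and> z x - z t0 = (x - t0) * l"
    by (rule MVT[OF \<open>t0 < x\<close>])
      (use deriv t0(1) in \<open>auto simp: S_def real_differentiable_def intro: continuous_on_subset[OF cz]\<close>)
  then obtain l u where lu: "t0 < u" "u < x" "(z has_real_derivative l) (at u)" "z x - z t0 = (x - t0) * l"
    by blast
  have "l \<le> 0" using deriv[OF lu(1,2)] lu(3) DERIV_unique by blast
  then have "(x - t0) * l \<le> 0" using \<open>t0 < x\<close> by (simp add: mult_nonneg_nonpos)
  then have "z x \<le> z t0" using lu(4) by simp
  then show False using pos[OF \<open>t0 < x\<close>] t0(1) by (simp add: S_def)
qed

section \<open>The radial equation as a system\<close>

definition pucci :: "real \<Rightarrow> real \<Rightarrow> real \<Rightarrow> real" where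
  "pucci a A t = pucci_coeff a A t * t"

definition pucci_inv :: "real \<Rightarrow> real \<Rightarrow> real \<Rightarrow> real" where
  "pucci_inv a A t = (if t > 0 then t / A else t / a)"

text \<open>
  The parameters are \<open>n = N - 1\<close> and \<open>p = 1 + \<alpha>\<close>. With the flux \<open>q = \<bar>v'\<bar>\<^sup>\<alpha> v'\<close>, which has the sign of
  \<open>v'\<close>, and the increasing bijection \<open>G t = \<Gamma>(t) t\<close>, the equation reads
  \<open>G(q'/p) + (n/r) G(q) = -\<mu> \<bar>v\<bar>\<^sup>\<alpha> v\<close>.
\<close>

locale radial_pucci =
  fixes n p a A :: real
  assumes n_nonneg: "n \<ge> 0" and p_pos: "p > 0" and a_pos: "a > 0" and a_le_A: "a \<le> A"
begin

abbreviation G where "G \<equiv> pucci a A"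
abbreviation Ginv where "Ginv \<equiv> pucci_inv a A"

lemma A_pos: "A > 0"
  using a_pos a_le_A by simp

lemma Ginv_eq_iff: "Ginv s = t \<longleftrightarrow> s = G t"
  using a_pos A_pos by (auto simp: pucci_def pucci_coeff_def pucci_inv_def field_simps zero_less_mult_iff)

lemma G_mono: "s \<le> t \<Longrightarrow> G s \<le> G t"
  using a_pos A_pos
  by (auto simp: pucci_def pucci_coeff_def mult_le_0_iff intro: order_trans[of _ 0])

lemma G_abs_le: "\<bar>G t\<bar> \<le> A * \<bar>t\<bar>"
  using a_pos A_pos a_le_A by (auto simp: pucci_def pucci_coeff_def abs_mult mult_right_mono)

lemma G_mult: "c \<ge> 0 \<Longrightarrow> G (c * t) = c * G t"
  by (cases "c = 0") (auto simp: pucci_def pucci_coeff_def zero_less_mult_iff)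

lemma Ginv_mult: "c \<ge> 0 \<Longrightarrow> Ginv (c * t) = c * Ginv t"
  by (cases "c = 0") (auto simp: pucci_inv_def zero_less_mult_iff)

lemma G_continuous: "continuous_on S G"
proof -
  have "G t = A * max t 0 + a * min t 0" for t
    by (auto simp: pucci_def pucci_coeff_def)
  then have "G = (\<lambda>t. A * max t 0 + a * min t 0)" by auto
  moreover have "continuous_on S (\<lambda>t. A * max t 0 + a * min t 0)" by (intro continuous_intros)
  ultimately show ?thesis by simp
qed

lemma Ginv_continuous: "continuous_on S Ginv"
proof -
  have "Ginv t = max t 0 / A + min t 0 / a" for t
    by (auto simp: pucci_inv_def)
  then have "Ginv = (\<lambda>t. max t 0 / A + min t 0 / a)" by auto
  moreover have "continuous_on S (\<lambda>t. max t 0 / A + min t 0 / a)"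
    using a_pos A_pos by (intro continuous_intros) auto
  ultimately show ?thesis by simp
qed

lemma Ginv_mono: "s \<le> t \<Longrightarrow> Ginv s \<le> Ginv t"
  using a_pos A_pos by (auto simp: pucci_inv_def divide_right_mono divide_le_0_iff zero_le_divide_iff intro: order_trans[of _ 0])

lemma Ginv_diff_le: "Ginv s - Ginv t \<le> \<bar>s - t\<bar> / a"
proof (cases "s \<le> t")
  case True
  then show ?thesis using Ginv_mono[OF True] a_pos by (smt (verit) divide_nonneg_pos)
next
  case False
  have "u / A \<le> u / a" if "u \<ge> 0" for u
    using that a_pos a_le_A by (simp add: frac_le)
  from this[of s] this[of "s - t"] this[of t] show ?thesis
    using False by (auto simp: pucci_inv_def diff_divide_distrib)
qed

text \<open>
  The equation solved for the derivative of the flux.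
\<close>

definition rhs :: "real \<Rightarrow> real \<Rightarrow> real \<Rightarrow> real \<Rightarrow> real" where
  "rhs \<mu> r y q = p * Ginv (- \<mu> * spow p y - n / r * G q)"

lemma rhs_0 [simp]: "rhs \<mu> r 0 0 = 0"
  by (simp add: rhs_def pucci_def pucci_inv_def)

text \<open>
  The damping term is decreasing in the flux, so its factor \<open>1/r\<close>, singular at the origin, drops out
  of one-sided differences. Estimates of fluxes by comparison therefore hold uniformly up to \<open>r = 0\<close>.
\<close>

lemma rhs_diff_le:
  assumes "\<mu> \<ge> 0" "r > 0" "q2 \<le> q1"
  shows "rhs \<mu> r y1 q1 - rhs \<mu> r y2 q2 \<le> p * \<mu> / a * \<bar>spow p y1 - spow p y2\<bar>"
proof -
  have "n / r * G q2 \<le> n / r * G q1"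
    using assms n_nonneg by (intro mult_left_mono G_mono) auto
  then have "Ginv (- \<mu> * spow p y1 - n / r * G q1) \<le> Ginv (- \<mu> * spow p y1 - n / r * G q2)"
    by (intro Ginv_mono) simp
  moreover have "Ginv (- \<mu> * spow p y1 - n / r * G q2) - Ginv (- \<mu> * spow p y2 - n / r * G q2)
      \<le> \<bar>(- \<mu> * spow p y1 - n / r * G q2) - (- \<mu> * spow p y2 - n / r * G q2)\<bar> / a"
    by (rule Ginv_diff_le)
  moreover have "(- \<mu> * spow p y1 - n / r * G q2) - (- \<mu> * spow p y2 - n / r * G q2)
      = - \<mu> * (spow p y1 - spow p y2)"
    by (simp add: algebra_simps)
  ultimately have "Ginv (- \<mu> * spow p y1 - n / r * G q1) - Ginv (- \<mu> * spow p y2 - n / r * G q2)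
      \<le> \<mu> * \<bar>spow p y1 - spow p y2\<bar> / a"
    using assms(1) by (simp add: abs_mult)
  from mult_left_mono[OF this, of p] p_pos show ?thesis
    by (simp add: rhs_def algebra_simps)
qed

text \<open>
  The system is singular at \<open>r = 0\<close>, so it is imposed in the interior only; \<open>v 0\<close> is left free as the
  initial value.
\<close>

definition solution :: "real \<Rightarrow> real \<Rightarrow> (real \<Rightarrow> real) \<Rightarrow> (real \<Rightarrow> real) \<Rightarrow> bool" where
  "solution \<mu> R v q \<longleftrightarrow>
     continuous_on {0..R} v \<and> continuous_on {0..R} q \<and> q 0 = 0 \<and>
     (\<forall>r\<in>{0<..<R}. (v has_real_derivative spow (1 / p) (q r)) (at r) \<and>
                   (q has_real_derivative rhs \<mu> r (v r) (q r)) (at r))"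

lemma solution_continuous:
  assumes "solution \<mu> R v q" "S \<subseteq> {0..R}"
  shows "continuous_on S v" "continuous_on S q"
  using assms by (auto simp: solution_def intro: continuous_on_subset)

lemma solution_derivative:
  assumes "solution \<mu> R v q" "0 < r" "r < R"
  shows "(v has_real_derivative spow (1 / p) (q r)) (at r)"
    "(q has_real_derivative rhs \<mu> r (v r) (q r)) (at r)"
  using assms by (auto simp: solution_def)

section \<open>Uniqueness for the initial value problem\<close>

text \<open>
  Homogeneity replaces a Lipschitz condition: if \<open>V\<close> is the maximum of \<open>\<bar>v\<bar>\<close> on \<open>[T, T + \<delta>]\<close>, then
  \<open>\<bar>q\<bar>\<close> is at most \<open>C \<delta>\<close> times the \<open>p\<close>-th power of \<open>V\<close>, hence \<open>\<bar>v'\<bar> \<le> V\<close> once \<open>C \<delta> \<le> 1\<close>, and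
  integrating gives \<open>V \<le> \<delta> V \<le> V/2\<close>.
\<close>

lemma double_zero_local:
  assumes sol: "solution \<mu> R v q" and \<mu>: "\<mu> \<ge> 0" and T: "0 \<le> T" "T < R" and zero: "v T = 0" "q T = 0"
  obtains \<delta> where "\<delta> > 0" "T + \<delta> \<le> R" "\<And>r. r \<in> {T..T + \<delta>} \<Longrightarrow> v r = 0 \<and> q r = 0"
proof -
  define C where "C = p * \<mu> / a"
  have C: "C \<ge> 0" using \<mu> p_pos a_pos by (simp add: C_def)
  define \<delta> where "\<delta> = min (R - T) (min (1 / 2) (1 / (C + 1)))"
  have \<delta>: "\<delta> > 0" "T + \<delta> \<le> R" "\<delta> \<le> 1 / 2" and "\<delta> \<le> 1 / (C + 1)"
  proof -
    show "\<delta> > 0" "T + \<delta> \<le> R" using T C by (auto simp: \<delta>_def)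
    show "\<delta> \<le> 1 / 2" "\<delta> \<le> 1 / (C + 1)" unfolding \<delta>_def by linarith+
  qed
  then have C\<delta>: "C * \<delta> \<le> 1"
    using C by (simp add: field_simps)
  define J where "J = {T..T + \<delta>}"
  have J: "J \<subseteq> {0..R}" using T \<delta> by (auto simp: J_def)
  note cont = solution_continuous[OF sol J]
  have "continuous_on J (\<lambda>r. \<bar>v r\<bar>)" by (intro continuous_intros cont)
  moreover have "compact J" "J \<noteq> {}" using \<delta>(1) by (auto simp: J_def)
  ultimately obtain x where x: "x \<in> J" "\<And>r. r \<in> J \<Longrightarrow> \<bar>v r\<bar> \<le> \<bar>v x\<bar>"
    using continuous_attains_sup[of J "\<lambda>r. \<bar>v r\<bar>"] by blast
  define V where "V = \<bar>v x\<bar>"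
  have dq: "\<bar>rhs \<mu> r (v r) (q r)\<bar> \<le> C * V powr p \<or> q r * rhs \<mu> r (v r) (q r) \<le> 0" if "r \<in> J" "r > 0" for r
  proof -
    have "\<bar>spow p (v r)\<bar> \<le> V powr p"
      using x(2)[OF that(1)] p_pos by (simp add: abs_spow V_def powr_mono2)
    then have CV: "C * \<bar>spow p (v r)\<bar> \<le> C * V powr p"
      using C by (rule mult_left_mono)
    show ?thesis
    proof (cases "q r \<ge> 0")
      case True
      then show ?thesis
        using rhs_diff_le[OF \<mu> that(2) True, of "v r" 0] CV
        by (cases "rhs \<mu> r (v r) (q r) \<ge> 0") (auto simp: C_def mult_nonneg_nonpos)
    next
      case False
      then show ?thesis
        using rhs_diff_le[OF \<mu> that(2), of "q r" 0 0 "v r"] CV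
        by (cases "rhs \<mu> r (v r) (q r) \<ge> 0") (auto simp: C_def mult_nonpos_nonneg)
    qed
  qed
  have CV: "C * V powr p \<ge> 0" using C by simp
  have q_le: "\<sigma> * q r \<le> C * V powr p * (r - T)" if \<sigma>: "\<bar>\<sigma>\<bar> = 1" and r: "r \<in> J" for \<sigma> r
  proof (rule derivative_comparison[of T "T + \<delta>" "\<lambda>r. \<sigma> * q r"])
    fix t assume t: "T < t" "t < T + \<delta>" "C * V powr p * (t - T) < \<sigma> * q t"
    have pos: "\<sigma> * q t > 0"
      using t CV by (smt (verit) mult_nonneg_nonneg)
    have "\<sigma> * rhs \<mu> t (v t) (q t) \<le> C * V powr p"
      using dq[of t] t T pos \<sigma> CV
      by (auto simp: J_def abs_if mult_le_0_iff zero_less_mult_iff split: if_splits)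
    moreover have "((\<lambda>r. \<sigma> * q r) has_real_derivative \<sigma> * rhs \<mu> t (v t) (q t)) (at t)"
      using t T \<delta> by (intro DERIV_cmult solution_derivative[OF sol]) auto
    moreover have "((\<lambda>r. C * V powr p * (r - T)) has_real_derivative C * V powr p) (at t)"
      by (auto intro!: derivative_eq_intros)
    ultimately show "\<exists>f' g'. ((\<lambda>r. \<sigma> * q r) has_real_derivative f') (at t) \<and>
        ((\<lambda>r. C * V powr p * (r - T)) has_real_derivative g') (at t) \<and> f' \<le> g'"
      by blast
  qed (use zero r cont in \<open>auto simp: J_def intro!: continuous_intros\<close>)
  have q_abs: "\<bar>q r\<bar> \<le> C * V powr p * (r - T)" if "r \<in> J" for r
    using q_le[of 1 r] q_le[of "-1" r] that by (simp add: abs_le_iff)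
  have dv: "\<bar>spow (1 / p) (q r)\<bar> \<le> V" if "r \<in> J" for r
  proof -
    have "\<bar>q r\<bar> \<le> C * V powr p * \<delta>"
    proof (rule order_trans[OF q_abs[OF that]])
      show "C * V powr p * (r - T) \<le> C * V powr p * \<delta>"
        using that CV by (intro mult_left_mono) (auto simp: J_def)
    qed
    also have "\<dots> = (C * \<delta>) * V powr p" by simp
    also have "\<dots> \<le> V powr p" using mult_right_mono[OF C\<delta>, of "V powr p"] by simp
    finally have "\<bar>q r\<bar> powr (1 / p) \<le> (V powr p) powr (1 / p)"
      using p_pos by (intro powr_mono2) auto
    then show ?thesis
      using p_pos by (simp add: abs_spow powr_powr V_def)
  qed
  have v_le: "\<sigma> * v r \<le> V * (r - T)" if \<sigma>: "\<bar>\<sigma>\<bar> = 1" and r: "r \<in> J" for \<sigma> r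
  proof (rule derivative_comparison[of T "T + \<delta>" "\<lambda>r. \<sigma> * v r"])
    fix t assume t: "T < t" "t < T + \<delta>"
    have "\<sigma> * spow (1 / p) (q t) \<le> V"
      using dv[of t] t \<sigma> by (auto simp: J_def abs_if split: if_splits)
    moreover have "((\<lambda>r. \<sigma> * v r) has_real_derivative \<sigma> * spow (1 / p) (q t)) (at t)"
      using t T \<delta> by (intro DERIV_cmult solution_derivative[OF sol]) auto
    moreover have "((\<lambda>r. V * (r - T)) has_real_derivative V) (at t)"
      by (auto intro!: derivative_eq_intros)
    ultimately show "\<exists>f' g'. ((\<lambda>r. \<sigma> * v r) has_real_derivative f') (at t) \<and>
        ((\<lambda>r. V * (r - T)) has_real_derivative g') (at t) \<and> f' \<le> g'"
      by blast
  qed (use zero r cont in \<open>auto simp: J_def intro!: continuous_intros\<close>)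
  have "V \<le> V * (x - T)"
  proof -
    have "v x \<le> V * (x - T)" "- v x \<le> V * (x - T)"
      using v_le[of 1 x] v_le[of "-1" x] x(1) by simp_all
    then show ?thesis unfolding V_def by linarith
  qed
  also have "\<dots> \<le> V * (1 / 2)"
    using x(1) \<delta> by (intro mult_left_mono) (auto simp: J_def V_def)
  finally have "V = 0" by (simp add: V_def)
  then have "v r = 0 \<and> q r = 0" if "r \<in> J" for r
    using x(2)[OF that] q_abs[OF that] by (simp add: V_def)
  then show ?thesis
    using that \<delta> by (simp add: J_def)
qed

lemma sign_persists:
  fixes f :: "real \<Rightarrow> real"
  assumes f: "continuous_on {0..R} f" and T: "0 \<le> T" "T < R" and nz: "f T \<noteq> 0"
  obtains \<delta> where "\<delta> > 0" "\<delta> \<le> 1" "T + \<delta> \<le> R"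
    "\<And>s. 0 \<le> s \<Longrightarrow> s \<le> \<delta> \<Longrightarrow> \<bar>f T\<bar> / 2 \<le> sgn (f T) * f (T + s)"
proof -
  have "T \<in> {0..R}" using T by simp
  then obtain d where d: "d > 0" "\<And>x. x \<in> {0..R} \<Longrightarrow> dist x T < d \<Longrightarrow> dist (f x) (f T) < \<bar>f T\<bar> / 2"
    using f nz unfolding continuous_on_iff by (metis half_gt_zero zero_less_abs_iff)
  define \<delta> where "\<delta> = min (d / 2) (min 1 (R - T))"
  have \<delta>: "\<delta> > 0" "\<delta> \<le> 1" "T + \<delta> \<le> R" "\<delta> < d"
    using d(1) T by (auto simp: \<delta>_def min_def)
  show ?thesis
  proof (rule that[OF \<delta>(1-3)])
    fix s assume s: "0 \<le> s" "s \<le> \<delta>"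
    have "dist (f (T + s)) (f T) < \<bar>f T\<bar> / 2"
      using s \<delta> T by (intro d(2)) (auto simp: dist_real_def)
    then show "\<bar>f T\<bar> / 2 \<le> sgn (f T) * f (T + s)"
      using nz by (auto simp: dist_real_def sgn_if abs_if split: if_splits)
  qed
qed

text \<open>
  Where \<open>\<sigma> v\<close> is bounded below and the flux is not yet of size \<open>\<epsilon> s\<close> in the direction \<open>-\<sigma>\<close>, the damping
  term is too small to balance \<open>\<mu> \<bar>v\<bar>\<^sup>\<alpha> v\<close>, because \<open>s/r \<le> 1\<close>. The flux is then driven in the direction
  \<open>-\<sigma>\<close> at a fixed rate.
\<close>

lemma rhs_pushes_away:
  assumes \<sigma>: "\<bar>\<sigma>\<bar> = 1" and \<mu>: "\<mu> > 0" and m: "0 < m" "m \<le> \<sigma> * y" and r: "0 < r" "0 \<le> s" "s \<le> r"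
    and q: "- (\<epsilon> * s) \<le> \<sigma> * q" and \<epsilon>: "\<epsilon> \<ge> 0" "n * A * \<epsilon> \<le> \<mu> * m powr p / 2"
  shows "\<sigma> * rhs \<mu> r y q \<le> - (p * (\<mu> * m powr p) / (2 * A))"
proof -
  define \<kappa> where "\<kappa> = \<mu> * m powr p"
  have \<kappa>: "\<kappa> > 0" using \<mu> m by (simp add: \<kappa>_def)
  have G: "- (n * A * \<epsilon>) \<le> n / r * (\<sigma> * G q)"
  proof -
    have "- (A * (\<epsilon> * s)) \<le> \<sigma> * G q"
    proof (cases "\<sigma> * q \<ge> 0")
      case True
      then have "\<sigma> * G q \<ge> 0"
        using \<sigma> a_pos A_pos by (auto simp: pucci_def pucci_coeff_def abs_if zero_le_mult_iff mult_le_0_iff split: if_splits)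
      then show ?thesis using A_pos \<epsilon>(1) r(2) by (smt (verit) mult_nonneg_nonneg)
    next
      case False
      have "\<bar>\<sigma> * G q\<bar> \<le> A * \<bar>\<sigma> * q\<bar>"
        using G_abs_le[of q] \<sigma> by (simp add: abs_mult)
      also have "\<dots> \<le> A * (\<epsilon> * s)"
        using False q A_pos by (intro mult_left_mono) auto
      finally show ?thesis by linarith
    qed
    then have "n / r * (- (A * (\<epsilon> * s))) \<le> n / r * (\<sigma> * G q)"
      using n_nonneg r by (intro mult_left_mono) auto
    moreover have "(n * A * \<epsilon>) * (s / r) \<le> n * A * \<epsilon> * 1"
      using n_nonneg A_pos \<epsilon>(1) r by (intro mult_left_mono) auto
    ultimately show ?thesis by (simp add: field_simps)
  qed
  have "\<kappa> \<le> \<mu> * (\<sigma> * spow p y)"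
    using spow_ge[OF p_pos m] \<mu> \<sigma> by (simp add: \<kappa>_def spow_sign_mult)
  then have arg: "\<sigma> * (- \<mu> * spow p y - n / r * G q) \<le> - (\<kappa> / 2)"
  proof -
    have "\<sigma> * (- \<mu> * spow p y - n / r * G q) = - (\<mu> * (\<sigma> * spow p y)) - n / r * (\<sigma> * G q)"
      by (simp add: algebra_simps)
    then show ?thesis using G \<epsilon>(2) \<open>\<kappa> \<le> \<mu> * (\<sigma> * spow p y)\<close> by (simp add: \<kappa>_def del: mult_minus_left)
  qed
  have "\<sigma> * Ginv t \<le> - (\<kappa> / (2 * A))" if t: "\<sigma> * t \<le> - (\<kappa> / 2)" for t
  proof (cases "\<sigma> = 1")
    case True
    then have "Ginv t = t / a" "t < 0" using t \<kappa> by (auto simp: pucci_inv_def)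
    moreover have "t / a \<le> t / A"
      using \<open>t < 0\<close> a_pos a_le_A by (simp add: divide_left_mono_neg)
    moreover have "t / A \<le> - (\<kappa> / 2) / A"
      using t True A_pos by (intro divide_right_mono) auto
    ultimately show ?thesis using True by simp
  next
    case False
    then have "\<sigma> = -1" using \<sigma> by (auto simp: abs_if split: if_splits)
    then have "t > 0" "\<kappa> / 2 \<le> t" using t \<kappa> by auto
    moreover from this(2) have "\<kappa> / 2 / A \<le> t / A"
      using A_pos by (intro divide_right_mono) auto
    ultimately show ?thesis using \<open>\<sigma> = -1\<close> by (simp add: pucci_inv_def)
  qed
  from mult_left_mono[OF this[OF arg], of p] p_pos show ?thesis
    by (simp add: rhs_def \<kappa>_def algebra_simps)
qed

text \<open>
  Whichever of \<open>v\<close> and \<open>q\<close> is nonzero at \<open>T\<close> keeps its sign and forces the other one, if it vanishes at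
  \<open>T\<close>, to grow at least linearly in modulus. The signs depend only on the values at \<open>T\<close>, so they are common to any
  two solutions that agree there.
\<close>

lemma solution_leaves_zero:
  assumes sol: "solution \<mu> R v q" and \<mu>: "\<mu> > 0" and T: "0 \<le> T" "T < R"
    and nz: "v T \<noteq> 0 \<or> q T \<noteq> 0"
  obtains c \<delta> where "c > 0" "\<delta> > 0" "\<delta> \<le> 1" "T + \<delta> \<le> R"
    "\<And>s. 0 < s \<Longrightarrow> s \<le> \<delta> \<Longrightarrow> c * s \<le> (if v T \<noteq> 0 then sgn (v T) else sgn (q T)) * v (T + s)"
    "\<And>s. 0 < s \<Longrightarrow> s \<le> \<delta> \<Longrightarrow> c * s \<le> (if q T \<noteq> 0 then sgn (q T) else - sgn (v T)) * q (T + s)"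
proof -
  have cont: "continuous_on {0..R} v" "continuous_on {0..R} q"
    using solution_continuous[OF sol] by auto
  consider "v T \<noteq> 0" "q T \<noteq> 0" | "v T \<noteq> 0" "q T = 0" | "v T = 0" "q T \<noteq> 0"
    using nz by blast
  then show ?thesis
  proof cases
    case 1
    obtain d where d: "d > 0" "d \<le> 1" "T + d \<le> R"
      "\<And>s. 0 \<le> s \<Longrightarrow> s \<le> d \<Longrightarrow> \<bar>v T\<bar> / 2 \<le> sgn (v T) * v (T + s)"
      using sign_persists[OF cont(1) T 1(1)] by metis
    obtain e where e: "e > 0" "e \<le> 1" "T + e \<le> R"
      "\<And>s. 0 \<le> s \<Longrightarrow> s \<le> e \<Longrightarrow> \<bar>q T\<bar> / 2 \<le> sgn (q T) * q (T + s)"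
      using sign_persists[OF cont(2) T 1(2)] by metis
    define c where "c = min (\<bar>v T\<bar> / 2) (\<bar>q T\<bar> / 2)"
    have c: "c > 0" "c \<le> \<bar>v T\<bar> / 2" "c \<le> \<bar>q T\<bar> / 2" using 1 by (auto simp: c_def)
    have cs: "c * s \<le> c" if "s \<le> 1" for s
      using mult_left_mono[OF that, of c] c(1) by simp
    show ?thesis
    proof (rule that[OF c(1), of "min d e"])
      fix s assume s: "0 < s" "s \<le> min d e"
      then have "c * s \<le> c" using d(2) by (intro cs) simp
      then have "c * s \<le> sgn (v T) * v (T + s)" "c * s \<le> sgn (q T) * q (T + s)"
        using d(4)[of s] e(4)[of s] s c by linarith+
      then show "c * s \<le> (if v T \<noteq> 0 then sgn (v T) else sgn (q T)) * v (T + s)"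
        "c * s \<le> (if q T \<noteq> 0 then sgn (q T) else - sgn (v T)) * q (T + s)"
        using 1 by simp_all
    qed (use d e in auto)
  next
    case 2
    obtain d where d: "d > 0" "d \<le> 1" "T + d \<le> R"
      "\<And>s. 0 \<le> s \<Longrightarrow> s \<le> d \<Longrightarrow> \<bar>v T\<bar> / 2 \<le> sgn (v T) * v (T + s)"
      using sign_persists[OF cont(1) T 2(1)] by metis
    define \<sigma> where "\<sigma> = sgn (v T)"
    have \<sigma>: "\<bar>\<sigma>\<bar> = 1" using 2 by (auto simp: \<sigma>_def)
    define m where "m = \<bar>v T\<bar> / 2"
    have m: "m > 0" using 2 by (simp add: m_def)
    define \<kappa> where "\<kappa> = \<mu> * m powr p"
    have \<kappa>: "\<kappa> > 0" using \<mu> m by (simp add: \<kappa>_def)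
    \<comment> \<open>the first bound makes \<open>- \<epsilon> (r - T)\<close> an upper barrier, the second one absorbs the damping term\<close>
    define \<epsilon> where "\<epsilon> = min (p * \<kappa> / (2 * A)) (\<kappa> / (2 * (n * A + 1)))"
    have nA: "n * A \<ge> 0" using n_nonneg A_pos by simp
    have \<epsilon>: "\<epsilon> > 0" "\<epsilon> \<le> p * \<kappa> / (2 * A)" and \<epsilon>2: "\<epsilon> \<le> \<kappa> / (2 * (n * A + 1))"
      using p_pos \<kappa> A_pos nA by (auto simp: \<epsilon>_def)
    have "n * A * \<epsilon> \<le> (n * A + 1) * \<epsilon>" using \<epsilon>(1) by simp
    also have "\<dots> \<le> \<kappa> / 2" using \<epsilon>2 nA by (simp add: field_simps)
    finally have nA\<epsilon>: "n * A * \<epsilon> \<le> \<kappa> / 2" .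
    have q_le: "\<sigma> * q r \<le> - (\<epsilon> * (r - T))" if r: "r \<in> {T..T + d}" for r
    proof (rule derivative_comparison[of T "T + d" "\<lambda>r. \<sigma> * q r" "\<lambda>r. - (\<epsilon> * (r - T))"])
      fix t assume t: "T < t" "t < T + d" "- (\<epsilon> * (t - T)) < \<sigma> * q t"
      have "\<sigma> * rhs \<mu> t (v t) (q t) \<le> - (p * (\<mu> * m powr p) / (2 * A))"
        using t T \<epsilon> nA\<epsilon> m d(4)[of "t - T"]
        by (intro rhs_pushes_away[where s = "t - T" and \<epsilon> = \<epsilon>] \<sigma> \<mu>)
          (auto simp: \<sigma>_def m_def \<kappa>_def)
      also have "\<dots> \<le> - \<epsilon>" using \<epsilon>(2) by (simp add: \<kappa>_def)
      finally have "\<sigma> * rhs \<mu> t (v t) (q t) \<le> - \<epsilon>" .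
      moreover have "((\<lambda>r. \<sigma> * q r) has_real_derivative \<sigma> * rhs \<mu> t (v t) (q t)) (at t)"
        using t T d by (intro DERIV_cmult solution_derivative[OF sol]) auto
      moreover have "((\<lambda>r. - (\<epsilon> * (r - T))) has_real_derivative - \<epsilon>) (at t)"
        by (auto intro!: derivative_eq_intros)
      ultimately show "\<exists>f' g'. ((\<lambda>r. \<sigma> * q r) has_real_derivative f') (at t) \<and>
          ((\<lambda>r. - (\<epsilon> * (r - T))) has_real_derivative g') (at t) \<and> f' \<le> g'"
        by blast
    next
      have "{T..T + d} \<subseteq> {0..R}" using T d by auto
      then show "continuous_on {T..T + d} (\<lambda>r. \<sigma> * q r)"
        by (intro continuous_intros continuous_on_subset[OF cont(2)])
    qed (use 2 r in \<open>auto intro!: continuous_intros\<close>)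
    define c where "c = min m \<epsilon>"
    have c: "c > 0" "c \<le> m" "c \<le> \<epsilon>" using m \<epsilon> by (auto simp: c_def)
    show ?thesis
    proof (rule that[OF c(1), of d])
      fix s assume s: "0 < s" "s \<le> d"
      have "c * s \<le> c * 1" using s d c by (intro mult_left_mono) auto
      then have "c * s \<le> sgn (v T) * v (T + s)"
        using d(4)[of s] s c unfolding m_def by linarith
      then show "c * s \<le> (if v T \<noteq> 0 then sgn (v T) else sgn (q T)) * v (T + s)"
        using 2 by simp
      have "c * s \<le> \<epsilon> * s" using s c by (intro mult_right_mono) auto
      moreover have "\<sigma> * q (T + s) \<le> - (\<epsilon> * s)" using q_le[of "T + s"] s by simp
      ultimately have "c * s \<le> - \<sigma> * q (T + s)" by linarith
      then show "c * s \<le> (if q T \<noteq> 0 then sgn (q T) else - sgn (v T)) * q (T + s)"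
        using 2 by (simp add: \<sigma>_def)
    qed (use d in auto)
  next
    case 3
    obtain d where d: "d > 0" "d \<le> 1" "T + d \<le> R"
      "\<And>s. 0 \<le> s \<Longrightarrow> s \<le> d \<Longrightarrow> \<bar>q T\<bar> / 2 \<le> sgn (q T) * q (T + s)"
      using sign_persists[OF cont(2) T 3(2)] by metis
    define \<sigma> where "\<sigma> = sgn (q T)"
    have \<sigma>: "\<bar>\<sigma>\<bar> = 1" using 3 by (auto simp: \<sigma>_def)
    define m where "m = \<bar>q T\<bar> / 2"
    have m: "m > 0" using 3 by (simp add: m_def)
    define M where "M = m powr (1 / p)"
    have M: "M > 0" using m by (simp add: M_def)
    have v_ge: "M * (r - T) \<le> \<sigma> * v r" if r: "r \<in> {T..T + d}" for r
    proof (rule derivative_comparison[of T "T + d" "\<lambda>r. M * (r - T)" "\<lambda>r. \<sigma> * v r"])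
      fix t assume t: "T < t" "t < T + d"
      have "m powr (1 / p) \<le> spow (1 / p) (\<sigma> * q t)"
        using t d(4)[of "t - T"] m p_pos by (intro spow_ge) (auto simp: m_def \<sigma>_def)
      then have "M \<le> \<sigma> * spow (1 / p) (q t)"
        using \<sigma> by (simp add: M_def spow_sign_mult)
      moreover have "((\<lambda>r. \<sigma> * v r) has_real_derivative \<sigma> * spow (1 / p) (q t)) (at t)"
        using t T d by (intro DERIV_cmult solution_derivative[OF sol]) auto
      moreover have "((\<lambda>r. M * (r - T)) has_real_derivative M) (at t)"
        by (auto intro!: derivative_eq_intros)
      ultimately show "\<exists>f' g'. ((\<lambda>r. M * (r - T)) has_real_derivative f') (at t) \<and>
          ((\<lambda>r. \<sigma> * v r) has_real_derivative g') (at t) \<and> f' \<le> g'"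
        by blast
    next
      have "{T..T + d} \<subseteq> {0..R}" using T d by auto
      then show "continuous_on {T..T + d} (\<lambda>r. \<sigma> * v r)"
        by (intro continuous_intros continuous_on_subset[OF cont(1)])
    qed (use 3 r in \<open>auto intro!: continuous_intros\<close>)
    define c where "c = min m M"
    have c: "c > 0" "c \<le> m" "c \<le> M" using m M by (auto simp: c_def)
    show ?thesis
    proof (rule that[OF c(1), of d])
      fix s assume s: "0 < s" "s \<le> d"
      have "c * s \<le> c * 1" using s d c by (intro mult_left_mono) auto
      then have "c * s \<le> sgn (q T) * q (T + s)"
        using d(4)[of s] s c unfolding m_def by linarith
      then show "c * s \<le> (if q T \<noteq> 0 then sgn (q T) else - sgn (v T)) * q (T + s)"
        using 3 by simp
      have "c * s \<le> M * s" using s c by (intro mult_right_mono) auto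
      also have "\<dots> \<le> \<sigma> * v (T + s)" using v_ge[of "T + s"] s by simp
      finally show "c * s \<le> (if v T \<noteq> 0 then sgn (v T) else sgn (q T)) * v (T + s)"
        using 3 by (simp add: \<sigma>_def)
    qed (use d in auto)
  qed
qed

lemma solution_bounded:
  assumes "solution \<mu> R v q"
  obtains M where "\<And>r. r \<in> {0..R} \<Longrightarrow> \<bar>v r\<bar> \<le> M \<and> \<bar>q r\<bar> \<le> M"
proof -
  have "bounded (v ` {0..R})" "bounded (q ` {0..R})"
    using solution_continuous[OF assms order_refl] by (auto intro!: compact_imp_bounded compact_continuous_image)
  then obtain B C where "\<forall>r\<in>{0..R}. \<bar>v r\<bar> \<le> B" "\<forall>r\<in>{0..R}. \<bar>q r\<bar> \<le> C"
    unfolding bounded_real by auto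
  then have "\<bar>v r\<bar> \<le> max B C \<and> \<bar>q r\<bar> \<le> max B C" if "r \<in> {0..R}" for r
    using that by (meson le_max_iff_disj)
  then show ?thesis by (rule that)
qed

text \<open>
  Both solutions leave zero linearly with common signs, so the two odd powers in the system have
  Lipschitz constants of order \<open>(r - T)\<close> to the power \<open>\<kappa> - 1\<close>. With \<open>D\<close> the maximal distance of the two solutions on
  \<open>[T, T + \<eta>]\<close>, comparison with \<open>g\<close>, a primitive of this bound times \<open>D\<close>, gives \<open>D \<le> D/2\<close> for small \<open>\<eta>\<close>.
\<close>

lemma nonzero_local_uniqueness:
  assumes sol1: "solution \<mu> R v1 q1" and sol2: "solution \<mu> R v2 q2" and \<mu>: "\<mu> > 0"
    and T: "0 \<le> T" "T < R" and eq: "v1 T = v2 T" "q1 T = q2 T"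
    and nz: "v1 T \<noteq> 0 \<or> q1 T \<noteq> 0"
  obtains \<eta> where "\<eta> > 0" "T + \<eta> \<le> R" "\<And>r. r \<in> {T..T + \<eta>} \<Longrightarrow> v1 r = v2 r \<and> q1 r = q2 r"
proof -
  define \<sigma> where "\<sigma> = (if v1 T \<noteq> 0 then sgn (v1 T) else sgn (q1 T))"
  define \<tau> where "\<tau> = (if q1 T \<noteq> 0 then sgn (q1 T) else - sgn (v1 T))"
  have \<sigma>\<tau>: "\<bar>\<sigma>\<bar> = 1" "\<bar>\<tau>\<bar> = 1"
    using nz by (auto simp: \<sigma>_def \<tau>_def)
  obtain c1 d1 where 1: "c1 > 0" "d1 > 0" "d1 \<le> 1" "T + d1 \<le> R"
    "\<And>s. 0 < s \<Longrightarrow> s \<le> d1 \<Longrightarrow> c1 * s \<le> \<sigma> * v1 (T + s)"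
    "\<And>s. 0 < s \<Longrightarrow> s \<le> d1 \<Longrightarrow> c1 * s \<le> \<tau> * q1 (T + s)"
    using solution_leaves_zero[OF sol1 \<mu> T nz] unfolding \<sigma>_def \<tau>_def by metis
  have nz2: "v2 T \<noteq> 0 \<or> q2 T \<noteq> 0" using nz eq by simp
  obtain c2 d2 where 2: "c2 > 0" "d2 > 0" "d2 \<le> 1" "T + d2 \<le> R"
    "\<And>s. 0 < s \<Longrightarrow> s \<le> d2 \<Longrightarrow> c2 * s \<le> \<sigma> * v2 (T + s)"
    "\<And>s. 0 < s \<Longrightarrow> s \<le> d2 \<Longrightarrow> c2 * s \<le> \<tau> * q2 (T + s)"
    using solution_leaves_zero[OF sol2 \<mu> T nz2] unfolding \<sigma>_def \<tau>_def eq by metis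
  define c where "c = min c1 c2"
  have c: "c > 0" "c \<le> c1" "c \<le> c2" using 1 2 by (auto simp: c_def)
  define \<delta> where "\<delta> = min d1 d2"
  have \<delta>: "\<delta> > 0" "\<delta> \<le> 1" "T + \<delta> \<le> R" "\<delta> \<le> d1" "\<delta> \<le> d2"
    using 1 2 by (auto simp: \<delta>_def)
  have low: "c * s \<le> \<sigma> * v1 (T + s)" "c * s \<le> \<sigma> * v2 (T + s)"
    "c * s \<le> \<tau> * q1 (T + s)" "c * s \<le> \<tau> * q2 (T + s)" if s: "0 < s" "s \<le> \<delta>" for s
  proof -
    have "c * s \<le> c1 * s" "c * s \<le> c2 * s" using c s by (auto intro: mult_right_mono)
    then show "c * s \<le> \<sigma> * v1 (T + s)" "c * s \<le> \<sigma> * v2 (T + s)"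
      "c * s \<le> \<tau> * q1 (T + s)" "c * s \<le> \<tau> * q2 (T + s)"
      using 1(5,6)[of s] 2(5,6)[of s] s \<delta> by linarith+
  qed
  obtain M1 where M1: "\<And>r. r \<in> {0..R} \<Longrightarrow> \<bar>v1 r\<bar> \<le> M1 \<and> \<bar>q1 r\<bar> \<le> M1"
    using solution_bounded[OF sol1] by blast
  obtain M2 where M2: "\<And>r. r \<in> {0..R} \<Longrightarrow> \<bar>v2 r\<bar> \<le> M2 \<and> \<bar>q2 r\<bar> \<le> M2"
    using solution_bounded[OF sol2] by blast
  define M where "M = max M1 M2"
  have M: "\<bar>v1 r\<bar> \<le> M" "\<bar>q1 r\<bar> \<le> M" "\<bar>v2 r\<bar> \<le> M" "\<bar>q2 r\<bar> \<le> M" if "r \<in> {0..R}" for r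
    using M1[OF that] M2[OF that] by (auto simp: M_def)
  define \<kappa> where "\<kappa> = min 1 (min p (1 / p))"
  have \<kappa>: "\<kappa> > 0" "\<kappa> \<le> 1" "\<kappa> \<le> p" "\<kappa> \<le> 1 / p" using p_pos by (auto simp: \<kappa>_def)
  have "1 / p > 0" using p_pos by simp
  obtain K1 where K1: "K1 \<ge> 0" "\<And>\<sigma> s x y. \<bar>\<sigma>\<bar> = 1 \<Longrightarrow> 0 < s \<Longrightarrow> s \<le> 1 \<Longrightarrow> c * s \<le> \<sigma> * x \<Longrightarrow>
      c * s \<le> \<sigma> * y \<Longrightarrow> \<bar>x\<bar> \<le> M \<Longrightarrow> \<bar>y\<bar> \<le> M \<Longrightarrow>
      \<bar>spow p x - spow p y\<bar> \<le> K1 * s powr (\<kappa> - 1) * \<bar>x - y\<bar>"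
    using spow_lipschitz_away[OF p_pos c(1) \<kappa>(2,3)] by metis
  obtain K2 where K2: "K2 \<ge> 0" "\<And>\<sigma> s x y. \<bar>\<sigma>\<bar> = 1 \<Longrightarrow> 0 < s \<Longrightarrow> s \<le> 1 \<Longrightarrow> c * s \<le> \<sigma> * x \<Longrightarrow>
      c * s \<le> \<sigma> * y \<Longrightarrow> \<bar>x\<bar> \<le> M \<Longrightarrow> \<bar>y\<bar> \<le> M \<Longrightarrow>
      \<bar>spow (1 / p) x - spow (1 / p) y\<bar> \<le> K2 * s powr (\<kappa> - 1) * \<bar>x - y\<bar>"
    using spow_lipschitz_away[OF \<open>1 / p > 0\<close> c(1) \<kappa>(2,4)] by metis
  define C where "C = p * \<mu> / a"
  have C: "C \<ge> 0" using \<mu> p_pos a_pos by (simp add: C_def)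
  define K where "K = K2 + C * K1"
  have K: "K \<ge> 0" "K2 \<le> K" "C * K1 \<le> K" using K1(1) K2(1) C by (auto simp: K_def)
  \<comment> \<open>chosen so that the comparison function \<open>g\<close> stays below \<open>D/4\<close>\<close>
  define \<eta> where "\<eta> = min \<delta> ((\<kappa> / (4 * (K + 1))) powr (1 / \<kappa>))"
  have \<eta>: "\<eta> > 0" "\<eta> \<le> \<delta>" "\<eta> \<le> (\<kappa> / (4 * (K + 1))) powr (1 / \<kappa>)"
    using \<delta>(1) \<kappa>(1) K(1) by (auto simp: \<eta>_def)
  have "\<eta> powr \<kappa> \<le> ((\<kappa> / (4 * (K + 1))) powr (1 / \<kappa>)) powr \<kappa>"
    using \<eta> \<kappa> by (intro powr_mono2) auto
  then have \<eta>\<kappa>: "\<eta> powr \<kappa> \<le> \<kappa> / (4 * (K + 1))"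
    using \<kappa>(1) K(1) by (simp add: powr_powr)
  have "K / \<kappa> * \<eta> powr \<kappa> \<le> K / \<kappa> * (\<kappa> / (4 * (K + 1)))"
    using \<eta>\<kappa> \<kappa>(1) K(1) by (intro mult_left_mono) auto
  also have "\<dots> \<le> 1 / 4" using \<kappa>(1) K(1) by (simp add: field_simps)
  finally have K\<eta>: "K / \<kappa> * \<eta> powr \<kappa> \<le> 1 / 4" .
  define J where "J = {T..T + \<eta>}"
  have J: "J \<subseteq> {0..R}" using T \<eta> \<delta> by (auto simp: J_def)
  note cont = solution_continuous[OF sol1 J] solution_continuous[OF sol2 J]
  have "continuous_on J (\<lambda>r. \<bar>v1 r - v2 r\<bar> + \<bar>q1 r - q2 r\<bar>)" by (intro continuous_intros cont)
  moreover have "compact J" "J \<noteq> {}" using \<eta>(1) by (auto simp: J_def)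
  ultimately obtain x where x: "x \<in> J"
    "\<And>r. r \<in> J \<Longrightarrow> \<bar>v1 r - v2 r\<bar> + \<bar>q1 r - q2 r\<bar> \<le> \<bar>v1 x - v2 x\<bar> + \<bar>q1 x - q2 x\<bar>"
    using continuous_attains_sup[of J "\<lambda>r. \<bar>v1 r - v2 r\<bar> + \<bar>q1 r - q2 r\<bar>"] by blast
  define D where "D = \<bar>v1 x - v2 x\<bar> + \<bar>q1 x - q2 x\<bar>"
  have D: "D \<ge> 0" by (simp add: D_def)
  have D_ge: "\<bar>v1 r - v2 r\<bar> \<le> D" "\<bar>q1 r - q2 r\<bar> \<le> D" if "r \<in> J" for r
    using x(2)[OF that] by (auto simp: D_def)
  define g where "g r = D * K / \<kappa> * (r - T) powr \<kappa>" for r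
  have g_cont: "continuous_on J g"
    unfolding g_def using \<kappa>(1) by (intro continuous_intros continuous_on_powr') (auto simp: J_def)
  have g_deriv: "(g has_real_derivative K * (t - T) powr (\<kappa> - 1) * D) (at t)" if "t > T" for t
    unfolding g_def[abs_def] using that \<kappa>(1)
    by (auto intro!: derivative_eq_intros)
  have step: "\<bar>spow p (v1 t) - spow p (v2 t)\<bar> \<le> K1 * (t - T) powr (\<kappa> - 1) * D"
    "\<bar>spow (1 / p) (q1 t) - spow (1 / p) (q2 t)\<bar> \<le> K2 * (t - T) powr (\<kappa> - 1) * D"
    if t: "T < t" "t < T + \<eta>" for t
  proof -
    have tJ: "t \<in> J" using t by (simp add: J_def)
    have s: "0 < t - T" "t - T \<le> \<delta>" "t - T \<le> 1" using t \<eta> \<delta> by auto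
    note lo = low[OF s(1,2), simplified] and hi = M[OF subsetD[OF J tJ]]
    have "\<bar>spow p (v1 t) - spow p (v2 t)\<bar> \<le> K1 * (t - T) powr (\<kappa> - 1) * \<bar>v1 t - v2 t\<bar>"
      by (rule K1(2)[OF \<sigma>\<tau>(1) s(1,3) lo(1,2) hi(1,3)])
    also have "\<dots> \<le> K1 * (t - T) powr (\<kappa> - 1) * D"
      using K1(1) D_ge(1)[OF tJ] by (intro mult_left_mono) auto
    finally show "\<bar>spow p (v1 t) - spow p (v2 t)\<bar> \<le> K1 * (t - T) powr (\<kappa> - 1) * D" .
    have "\<bar>spow (1 / p) (q1 t) - spow (1 / p) (q2 t)\<bar> \<le> K2 * (t - T) powr (\<kappa> - 1) * \<bar>q1 t - q2 t\<bar>"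
      by (rule K2(2)[OF \<sigma>\<tau>(2) s(1,3) lo(3,4) hi(2,4)])
    also have "\<dots> \<le> K2 * (t - T) powr (\<kappa> - 1) * D"
      using K2(1) D_ge(2)[OF tJ] by (intro mult_left_mono) auto
    finally show "\<bar>spow (1 / p) (q1 t) - spow (1 / p) (q2 t)\<bar> \<le> K2 * (t - T) powr (\<kappa> - 1) * D" .
  qed
  \<comment> \<open>stated for an abstract pair because it is needed for both orders of the two solutions\<close>
  have le: "va r - vb r \<le> g r" "qa r - qb r \<le> g r"
    if sa: "solution \<mu> R va qa" and sb: "solution \<mu> R vb qb"
      and eab: "va T = vb T" "qa T = qb T"
      and sv: "\<And>t. T < t \<Longrightarrow> t < T + \<eta> \<Longrightarrow> \<bar>spow p (va t) - spow p (vb t)\<bar> \<le> K1 * (t - T) powr (\<kappa> - 1) * D"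
      and sq: "\<And>t. T < t \<Longrightarrow> t < T + \<eta> \<Longrightarrow> \<bar>spow (1 / p) (qa t) - spow (1 / p) (qb t)\<bar> \<le> K2 * (t - T) powr (\<kappa> - 1) * D"
      and r: "r \<in> J" for va qa vb qb r
  proof -
    have inside: "0 < t" "t < R" if "T < t" "t < T + \<eta>" for t
      using that T \<eta> \<delta> by auto
    have powD: "(t - T) powr (\<kappa> - 1) * D \<ge> 0" for t using D by simp
    show "va r - vb r \<le> g r"
    proof (rule derivative_comparison[of T "T + \<eta>" "\<lambda>r. va r - vb r" g])
      fix t assume t: "T < t" "t < T + \<eta>"
      have "K2 * ((t - T) powr (\<kappa> - 1) * D) \<le> K * ((t - T) powr (\<kappa> - 1) * D)"
        using K(2) powD by (rule mult_right_mono)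
      then have "spow (1 / p) (qa t) - spow (1 / p) (qb t) \<le> K * (t - T) powr (\<kappa> - 1) * D"
        using sq[OF t] by (simp add: mult.assoc)
      then show "\<exists>f' g'. ((\<lambda>r. va r - vb r) has_real_derivative f') (at t) \<and>
          (g has_real_derivative g') (at t) \<and> f' \<le> g'"
        using DERIV_diff[OF solution_derivative(1)[OF sa inside[OF t]] solution_derivative(1)[OF sb inside[OF t]]]
          g_deriv[OF t(1)] by blast
    qed (use r eab g_cont solution_continuous[OF sa J] solution_continuous[OF sb J]
        in \<open>auto simp: J_def g_def intro!: continuous_intros\<close>)
    show "qa r - qb r \<le> g r"
    proof (rule derivative_comparison[of T "T + \<eta>" "\<lambda>r. qa r - qb r" g])
      fix t assume t: "T < t" "t < T + \<eta>" and gt: "g t < qa t - qb t"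
      have "g t \<ge> 0" using D K \<kappa> by (simp add: g_def)
      then have "rhs \<mu> t (va t) (qa t) - rhs \<mu> t (vb t) (qb t) \<le> C * \<bar>spow p (va t) - spow p (vb t)\<bar>"
        using rhs_diff_le[of \<mu> t "qb t" "qa t" "va t" "vb t"] \<mu> inside[OF t] gt by (simp add: C_def)
      also have "\<dots> \<le> C * (K1 * (t - T) powr (\<kappa> - 1) * D)"
        using sv[OF t] C by (rule mult_left_mono)
      also have "\<dots> = C * K1 * ((t - T) powr (\<kappa> - 1) * D)" by simp
      also have "\<dots> \<le> K * ((t - T) powr (\<kappa> - 1) * D)"
        using K(3) powD by (rule mult_right_mono)
      finally have "rhs \<mu> t (va t) (qa t) - rhs \<mu> t (vb t) (qb t) \<le> K * (t - T) powr (\<kappa> - 1) * D"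
        by (simp add: mult.assoc)
      then show "\<exists>f' g'. ((\<lambda>r. qa r - qb r) has_real_derivative f') (at t) \<and>
          (g has_real_derivative g') (at t) \<and> f' \<le> g'"
        using DERIV_diff[OF solution_derivative(2)[OF sa inside[OF t]] solution_derivative(2)[OF sb inside[OF t]]]
          g_deriv[OF t(1)] by blast
    qed (use r eab g_cont solution_continuous[OF sa J] solution_continuous[OF sb J]
        in \<open>auto simp: J_def g_def intro!: continuous_intros\<close>)
  qed
  have "v1 x - v2 x \<le> g x" "q1 x - q2 x \<le> g x"
    by (rule le[OF sol1 sol2 eq step x(1)]; assumption)+
  moreover have "v2 x - v1 x \<le> g x" "q2 x - q1 x \<le> g x"
    by (rule le[OF sol2 sol1 eq[symmetric] _ _ x(1)];
        subst abs_minus_commute; rule step; assumption)+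
  ultimately have "D \<le> 2 * g x"
    by (simp add: D_def abs_if)
  moreover have "g x \<le> D * (1 / 4)"
  proof -
    have "(x - T) powr \<kappa> \<le> \<eta> powr \<kappa>"
      using x(1) \<kappa>(1) by (intro powr_mono2) (auto simp: J_def)
    then have "K / \<kappa> * (x - T) powr \<kappa> \<le> K / \<kappa> * \<eta> powr \<kappa>"
      using K(1) \<kappa>(1) by (intro mult_left_mono) auto
    then have "D * (K / \<kappa> * (x - T) powr \<kappa>) \<le> D * (1 / 4)"
      using order_trans[OF _ K\<eta>] D by (intro mult_left_mono) blast+
    then show ?thesis by (simp add: g_def)
  qed
  ultimately have "D = 0" using D by linarith
  then have "v1 r = v2 r \<and> q1 r = q2 r" if "r \<in> J" for r
    using D_ge[OF that] by simp
  then show ?thesis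
    using \<eta> \<delta> by (intro that[of \<eta>]) (auto simp: J_def)
qed

lemma local_uniqueness:
  assumes sol1: "solution \<mu> R v1 q1" and sol2: "solution \<mu> R v2 q2" and \<mu>: "\<mu> > 0"
    and T: "0 \<le> T" "T < R" and eq: "v1 T = v2 T" "q1 T = q2 T"
  obtains \<eta> where "\<eta> > 0" "T + \<eta> \<le> R" "\<And>r. r \<in> {T..T + \<eta>} \<Longrightarrow> v1 r = v2 r \<and> q1 r = q2 r"
proof (cases "v1 T = 0 \<and> q1 T = 0")
  case True
  obtain d where d: "d > 0" "T + d \<le> R" "\<And>r. r \<in> {T..T + d} \<Longrightarrow> v1 r = 0 \<and> q1 r = 0"
    using double_zero_local[OF sol1 less_imp_le[OF \<mu>] T] True by metis
  obtain e where e: "e > 0" "T + e \<le> R" "\<And>r. r \<in> {T..T + e} \<Longrightarrow> v2 r = 0 \<and> q2 r = 0"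
    using double_zero_local[OF sol2 less_imp_le[OF \<mu>] T] True eq by metis
  show ?thesis
    by (rule that[of "min d e"]) (use d e in auto)
next
  case False
  then show ?thesis
    using nonzero_local_uniqueness[OF sol1 sol2 \<mu> T eq] that by blast
qed

text \<open>
  Agreement of \<open>v\<close> and \<open>q\<close> is a closed condition, and it extends beyond any point up to which it holds.
\<close>

lemma solution_unique:
  assumes sol1: "solution \<mu> R v1 q1" and sol2: "solution \<mu> R v2 q2" and \<mu>: "\<mu> > 0"
    and init: "v1 0 = v2 0" and r: "r \<in> {0..R}"
  shows "v1 r = v2 r"
proof -
  define Z where "Z = {0..R} \<inter> (\<lambda>r. \<bar>v1 r - v2 r\<bar> + \<bar>q1 r - q2 r\<bar>) -` {0}"
  have Z_iff: "t \<in> Z \<longleftrightarrow> t \<in> {0..R} \<and> v1 t = v2 t \<and> q1 t = q2 t" for t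
    by (auto simp: Z_def add_nonneg_eq_0_iff)
  have "closed Z"
    unfolding Z_def using solution_continuous[OF sol1 order_refl] solution_continuous[OF sol2 order_refl]
    by (intro continuous_closed_preimage continuous_intros) auto
  define S where "S = {t \<in> {0..R}. {0..t} \<subseteq> Z}"
  have "R \<ge> 0" using r by simp
  have "q1 0 = q2 0" using sol1 sol2 by (simp add: solution_def)
  then have "0 \<in> S" using init \<open>R \<ge> 0\<close> by (simp add: S_def Z_iff)
  have bdd: "bdd_above S" by (rule bdd_aboveI[of _ R]) (simp add: S_def)
  define T where "T = Sup S"
  have T: "0 \<le> T" "T \<le> R"
  proof -
    show "0 \<le> T" unfolding T_def by (rule cSup_upper[OF \<open>0 \<in> S\<close> bdd])
    show "T \<le> R" unfolding T_def
    proof (rule cSup_least)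
      show "S \<noteq> {}" using \<open>0 \<in> S\<close> by blast
    qed (simp add: S_def)
  qed
  have below: "t \<in> Z" if t: "0 \<le> t" "t < T" for t
  proof -
    obtain u where "u \<in> S" "t < u"
      using t(2) less_cSup_iff[OF _ bdd] \<open>0 \<in> S\<close> unfolding T_def by blast
    then show ?thesis using t(1) by (auto simp: S_def)
  qed
  have "T \<in> Z"
  proof (cases "T = 0")
    case True
    then show ?thesis using \<open>0 \<in> S\<close> by (auto simp: S_def)
  next
    case False
    then have "T \<in> closure {0..<T}" using T by simp
    moreover have "closure {0..<T} \<subseteq> Z"
      using below \<open>closed Z\<close> by (intro closure_minimal) auto
    ultimately show ?thesis by blast
  qed
  have "T = R"
  proof (rule ccontr)
    assume "T \<noteq> R"
    then have "T < R" using T by simp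
    obtain \<eta> where \<eta>: "\<eta> > 0" "T + \<eta> \<le> R" "\<And>r. r \<in> {T..T + \<eta>} \<Longrightarrow> v1 r = v2 r \<and> q1 r = q2 r"
      using local_uniqueness[OF sol1 sol2 \<mu> T(1) \<open>T < R\<close>] \<open>T \<in> Z\<close> unfolding Z_iff by metis
    have "t \<in> Z" if "t \<in> {0..T + \<eta>}" for t
    proof (cases "t < T")
      case True
      then show ?thesis using below that by simp
    next
      case False
      then show ?thesis using \<eta>(2) \<eta>(3)[of t] that by (simp add: Z_iff)
    qed
    then have "T + \<eta> \<in> S" using \<eta> T by (auto simp: S_def)
    then show False using cSup_upper[OF _ bdd] \<eta>(1) unfolding T_def by fastforce
  qed
  then have "r \<in> Z" using below[of r] \<open>T \<in> Z\<close> r by (cases "r = R") auto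
  then show ?thesis by (simp add: Z_iff)
qed

section \<open>Sign of the eigenvalues and scaling\<close>

text \<open>
  For \<open>\<mu> \<le> 0\<close> the product \<open>q v\<close> cannot become negative: where it is negative, both terms of its
  derivative \<open>q' v + q v'\<close> are nonnegative. As \<open>q\<close> has the sign of \<open>v'\<close>, the square of \<open>v\<close> is nondecreasing,
  and it vanishes at the right end point.
\<close>

lemma solution_nonpositive_trivial:
  assumes sol: "solution \<mu> R v q" and \<mu>: "\<mu> \<le> 0" and zero: "v R = 0" and r: "r \<in> {0..R}"
  shows "v r = 0"
proof -
  note cont = solution_continuous[OF sol]
  have qv: "- (q t * v t) \<le> 0" if "t \<in> {0..R}" for t
  proof (rule derivative_comparison[of 0 R "\<lambda>t. - (q t * v t)" "\<lambda>_. 0"])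
    fix t assume t: "0 < t" "t < R" and neg: "0 < - (q t * v t)"
    have deriv: "((\<lambda>t. - (q t * v t)) has_real_derivative
        - (rhs \<mu> t (v t) (q t) * v t + spow (1 / p) (q t) * q t)) (at t)"
      by (intro DERIV_minus DERIV_mult solution_derivative[OF sol t])
    have "spow (1 / p) (q t) * q t \<ge> 0"
      by (simp add: spow_def sgn_if zero_le_mult_iff mult_le_0_iff)
    moreover have "rhs \<mu> t (v t) (q t) * v t \<ge> 0"
    proof (cases "v t > 0")
      case True
      then have "q t < 0" using neg by (simp add: mult_less_0_iff)
      then have "G (q t) \<le> 0" "spow p (v t) \<ge> 0"
        using True a_pos by (auto simp: pucci_def pucci_coeff_def spow_def mult_le_0_iff)
      moreover have "n / t \<ge> 0" using n_nonneg t by simp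
      ultimately have "- \<mu> * spow p (v t) \<ge> 0" "n / t * G (q t) \<le> 0"
        using \<mu> mult_nonneg_nonneg[of "- \<mu>"] mult_nonneg_nonpos[of "n / t"] by simp_all
      then have "rhs \<mu> t (v t) (q t) \<ge> 0"
        using p_pos a_pos A_pos by (auto simp: rhs_def pucci_inv_def)
      then show ?thesis using True by simp
    next
      case False
      then have vq: "v t < 0" "q t > 0" using neg by (auto simp: mult_less_0_iff)
      then have "G (q t) \<ge> 0" "spow p (v t) \<le> 0"
        using A_pos by (auto simp: pucci_def pucci_coeff_def spow_def)
      moreover have "n / t \<ge> 0" using n_nonneg t by simp
      ultimately have "- \<mu> * spow p (v t) \<le> 0" "n / t * G (q t) \<ge> 0"
        using \<mu> mult_nonneg_nonpos[of "- \<mu>"] mult_nonneg_nonneg[of "n / t"] by simp_all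
      then have "rhs \<mu> t (v t) (q t) \<le> 0"
        using p_pos a_pos A_pos
        by (auto simp: rhs_def pucci_inv_def mult_le_0_iff divide_le_0_iff)
      then show ?thesis using vq by (simp add: mult_nonpos_nonpos)
    qed
    ultimately show "\<exists>f' g'. ((\<lambda>t. - (q t * v t)) has_real_derivative f') (at t) \<and>
        ((\<lambda>_. 0) has_real_derivative g') (at t) \<and> f' \<le> g'"
      using deriv by (intro exI[of _ "- (rhs \<mu> t (v t) (q t) * v t + spow (1 / p) (q t) * q t)"] exI[of _ 0]) auto
  qed (use that sol cont[OF order_refl] in \<open>auto simp: solution_def intro!: continuous_intros\<close>)
  have "(v r)\<^sup>2 \<le> (v R)\<^sup>2"
  proof (rule derivative_comparison[of r R "\<lambda>_. (v r)\<^sup>2" "\<lambda>t. (v t)\<^sup>2"])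
    fix t assume t: "r < t" "t < R"
    then have t0: "0 < t" using r by simp
    have "((\<lambda>t. v t * v t) has_real_derivative
        spow (1 / p) (q t) * v t + spow (1 / p) (q t) * v t) (at t)"
      by (intro DERIV_mult solution_derivative[OF sol t0 t(2)])
    moreover have "spow (1 / p) (q t) * v t \<ge> 0"
      using qv[of t] t t0 by (auto simp: spow_def sgn_if zero_le_mult_iff mult_le_0_iff)
    then have "0 \<le> spow (1 / p) (q t) * v t + spow (1 / p) (q t) * v t" by linarith
    moreover have "((\<lambda>_. (v r)\<^sup>2) has_real_derivative 0) (at t)" by simp
    ultimately show "\<exists>f' g'. ((\<lambda>_. (v r)\<^sup>2) has_real_derivative f') (at t) \<and>
        ((\<lambda>t. (v t)\<^sup>2) has_real_derivative g') (at t) \<and> f' \<le> g'"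
      unfolding power2_eq_square by blast
  next
    show "continuous_on {r..R} (\<lambda>t. (v t)\<^sup>2)"
      using r by (intro continuous_intros cont) auto
  qed (use r in auto)
  then show ?thesis using zero by simp
qed

text \<open>
  Both sides of the equation are positively homogeneous of degree \<open>p\<close> in \<open>v\<close>, and a dilation by \<open>l\<close>
  multiplies the left-hand side by \<open>l\<close> to the power \<open>p + 1\<close>, which becomes the eigenvalue.
\<close>

lemma solution_scale:
  assumes sol: "solution 1 R w q" and l: "l > 0" and k: "k \<ge> 0"
  shows "solution (l powr (p + 1)) (R / l) (\<lambda>r. k * w (l * r)) (\<lambda>r. (k * l) powr p * q (l * r))"
  unfolding solution_def
proof (intro conjI ballI)
  have img: "(\<lambda>r. l * r) ` {0..R / l} \<subseteq> {0..R}"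
    using l by (auto simp: field_simps)
  show "continuous_on {0..R / l} (\<lambda>r. k * w (l * r))"
    by (intro continuous_intros continuous_on_compose2[OF solution_continuous(1)[OF sol order_refl] _ img])
  show "continuous_on {0..R / l} (\<lambda>r. (k * l) powr p * q (l * r))"
    by (intro continuous_intros continuous_on_compose2[OF solution_continuous(2)[OF sol order_refl] _ img])
  show "(k * l) powr p * q (l * 0) = 0" using sol by (simp add: solution_def)
  fix r assume r: "r \<in> {0<..<R / l}"
  then have lr: "0 < l * r" "l * r < R" using l by (auto simp: field_simps)
  have inner: "((\<lambda>r. l * r) has_real_derivative l) (at r)"
    by (auto intro!: derivative_eq_intros)
  have "spow (1 / p) ((k * l) powr p * q (l * r)) = k * l * spow (1 / p) (q (l * r))"
    using k l p_pos by (simp add: spow_mult powr_powr)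
  then show "((\<lambda>r. k * w (l * r)) has_real_derivative spow (1 / p) ((k * l) powr p * q (l * r))) (at r)"
    using DERIV_cmult[OF DERIV_chain2[OF solution_derivative(1)[OF sol lr] inner], of k]
    by (simp add: algebra_simps)
  have "- (l powr (p + 1)) * spow p (k * w (l * r)) - n / r * G ((k * l) powr p * q (l * r))
      = (l * (k * l) powr p) * (- 1 * spow p (w (l * r)) - n / (l * r) * G (q (l * r)))"
    using k l r by (simp add: spow_mult G_mult powr_mult powr_add field_simps)
  then have "rhs (l powr (p + 1)) r (k * w (l * r)) ((k * l) powr p * q (l * r))
      = (k * l) powr p * (rhs 1 (l * r) (w (l * r)) (q (l * r)) * l)"
    using l by (simp only: rhs_def) (simp add: Ginv_mult del: mult_minus1)
  then show "((\<lambda>r. (k * l) powr p * q (l * r)) has_real_derivative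
      rhs (l powr (p + 1)) r (k * w (l * r)) ((k * l) powr p * q (l * r))) (at r)"
    using DERIV_cmult[OF DERIV_chain2[OF solution_derivative(2)[OF sol lr] inner], of "(k * l) powr p"]
    by simp
qed

end

section \<open>Weak and classical solutions\<close>

lemma mult_pucci_coeff: "pucci_coeff a A t * t = pucci a A t"
  by (simp add: pucci_def)

lemma pucci_coeff_mult_spow:
  "pucci_coeff a A t * spow p t = pucci a A (spow p t)"
proof -
  have "0 < spow p t \<longleftrightarrow> 0 < t" by (auto simp: spow_def sgn_if zero_less_mult_iff)
  then show ?thesis by (simp add: pucci_def pucci_coeff_def)
qed

text \<open>
  The equation determines the distributional derivative of the flux almost everywhere as a function
  that is continuous in \<open>r > 0\<close>; by the lemma of du Bois-Reymond the flux is then \<open>C\<^sup>1\<close>.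
\<close>

lemma (in radial_pucci) radial_pucci_eq_iff_classical:
  assumes N: "n = real N - 1" and \<alpha>: "p = 1 + \<alpha>"
    and I: "open I" "is_interval I" "I \<subseteq> {0<..}"
    and g': "continuous_on I g'" and f: "continuous_on I f"
  shows "radial_pucci_eq N \<alpha> a A I g' f \<longleftrightarrow>
    (\<forall>r\<in>I. ((\<lambda>r. spow p (g' r)) has_real_derivative
        p * Ginv (f r - n / r * G (spow p (g' r)))) (at r))"
proof -
  define k where "k r = Ginv (f r - n / r * G (spow p (g' r)))" for r
  have q_cont: "continuous_on I (\<lambda>r. spow p (g' r))"
    by (rule continuous_on_spow[OF p_pos g'])
  have Gq_cont: "continuous_on I (\<lambda>r. G (spow p (g' r)))"
    using continuous_on_compose2[OF G_continuous[of UNIV] q_cont] by simp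
  have "continuous_on I (\<lambda>r. f r - n / r * G (spow p (g' r)))"
    using I(3) by (intro continuous_intros f Gq_cont) auto
  then have k_cont: "continuous_on I k"
    unfolding k_def using continuous_on_compose2[OF Ginv_continuous[of UNIV]] by blast
  have flux: "\<bar>g' r\<bar> powr \<alpha> * g' r = spow p (g' r)" for r
    using \<alpha> by (simp add: powr_abs_mult_eq_spow)
  have pointwise: "pucci_coeff a A (h r) * h r
      + pucci_coeff a A (g' r) * ((real N - 1) / r) * (\<bar>g' r\<bar> powr \<alpha> * g' r) = f r \<longleftrightarrow> h r = k r" for h r
  proof -
    have "pucci_coeff a A (g' r) * ((real N - 1) / r) * (\<bar>g' r\<bar> powr \<alpha> * g' r)
        = (real N - 1) / r * (pucci_coeff a A (g' r) * spow p (g' r))"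
      unfolding flux by simp
    also have "\<dots> = n / r * G (spow p (g' r))"
      by (simp add: N pucci_coeff_mult_spow)
    finally have "pucci_coeff a A (h r) * h r
      + pucci_coeff a A (g' r) * ((real N - 1) / r) * (\<bar>g' r\<bar> powr \<alpha> * g' r) = f r
      \<longleftrightarrow> f r - n / r * G (spow p (g' r)) = G (h r)"
      by (auto simp: mult_pucci_coeff)
    also have "\<dots> \<longleftrightarrow> h r = k r"
      unfolding k_def using Ginv_eq_iff by metis
    finally show ?thesis .
  qed
  have eq: "radial_pucci_eq N \<alpha> a A I g' f \<longleftrightarrow>
      (\<exists>h. has_distributional_derivative_on I (\<lambda>r. spow p (g' r) / p) h \<and>
           (AE r in lborel. r \<in> I \<longrightarrow> h r = k r))"
    unfolding radial_pucci_eq_def pointwise unfolding flux \<alpha>[symmetric] ..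
  show ?thesis
  proof
    assume "radial_pucci_eq N \<alpha> a A I g' f"
    then obtain h where h: "has_distributional_derivative_on I (\<lambda>r. spow p (g' r) / p) h"
      "AE r in lborel. r \<in> I \<longrightarrow> h r = k r" unfolding eq by blast
    have "continuous_on I (\<lambda>r. spow p (g' r) / p)"
      using p_pos by (intro continuous_intros q_cont) auto
    note D = distributional_derivative_continuous[OF I(1,2) h(1) this k_cont h(2)]
    show "\<forall>r\<in>I. ((\<lambda>r. spow p (g' r)) has_real_derivative
        p * Ginv (f r - n / r * G (spow p (g' r)))) (at r)"
    proof
      fix r assume "r \<in> I"
      from DERIV_cmult[OF D[OF this], of p] show "((\<lambda>r. spow p (g' r)) has_real_derivative
        p * Ginv (f r - n / r * G (spow p (g' r)))) (at r)"
        using p_pos by (simp add: k_def)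
    qed
  next
    assume D: "\<forall>r\<in>I. ((\<lambda>r. spow p (g' r)) has_real_derivative
        p * Ginv (f r - n / r * G (spow p (g' r)))) (at r)"
    have "((\<lambda>r. spow p (g' r) / p) has_real_derivative k r) (at r)" if "r \<in> I" for r
      using DERIV_cdivide[OF bspec[OF D that], of p] p_pos by (simp add: k_def)
    then have "has_distributional_derivative_on I (\<lambda>r. spow p (g' r) / p) k"
      by (rule derivative_imp_distributional_derivative[OF I(1,2) _ k_cont])
    then show "radial_pucci_eq N \<alpha> a A I g' f"
      unfolding eq by (intro exI[of _ k]) simp
  qed
qed

context
  fixes N :: nat and \<alpha> a A :: real
  assumes N: "N \<ge> 1" and \<alpha>: "\<alpha> > -1" and a: "0 < a" "a \<le> A"
begin

interpretation radial_pucci "real N - 1" "1 + \<alpha>" a A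
  using N \<alpha> a by unfold_locales auto

lemma solution_if_C1_on:
  assumes v: "C1_on J v v'" and J: "is_interval J" "{0..R} \<subseteq> J" and v'0: "v' 0 = 0"
    and eq: "radial_pucci_eq N \<alpha> a A I v' (\<lambda>r. - \<mu> * (\<bar>v r\<bar> powr \<alpha> * v r))"
    and I: "open I" "is_interval I" "{0<..<R} \<subseteq> I" "I \<subseteq> J" "I \<subseteq> {0<..}"
  shows "solution \<mu> R v (\<lambda>r. spow (1 + \<alpha>) (v' r))"
proof -
  have d: "(v has_real_derivative v' r) (at r within J)" if "r \<in> J" for r
    using v that by (simp add: C1_on_def)
  have v_cont: "continuous_on J v"
    by (rule DERIV_continuous_on[OF d])
  have v'_cont: "continuous_on J v'"
    using v by (simp add: C1_on_def)
  have q_cont: "continuous_on J (\<lambda>r. spow (1 + \<alpha>) (v' r))"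
    by (rule continuous_on_spow[OF p_pos v'_cont])
  have f_cont: "continuous_on I (\<lambda>r. - \<mu> * (\<bar>v r\<bar> powr \<alpha> * v r))"
    unfolding powr_abs_mult_eq_spow
    by (intro continuous_intros continuous_on_spow p_pos continuous_on_subset[OF v_cont I(4)])
  have q': "((\<lambda>r. spow (1 + \<alpha>) (v' r)) has_real_derivative
      rhs \<mu> r (v r) (spow (1 + \<alpha>) (v' r))) (at r)" if "r \<in> I" for r
    using eq that radial_pucci_eq_iff_classical[OF refl refl I(1,2,5)
        continuous_on_subset[OF v'_cont I(4)] f_cont]
    by (simp add: rhs_def powr_abs_mult_eq_spow)
  show ?thesis
    unfolding solution_def
  proof (intro conjI ballI)
    show "continuous_on {0..R} v" "continuous_on {0..R} (\<lambda>r. spow (1 + \<alpha>) (v' r))"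
      by (rule continuous_on_subset[OF v_cont J(2)], rule continuous_on_subset[OF q_cont J(2)])
    show "spow (1 + \<alpha>) (v' 0) = 0" by (simp add: v'0)
    fix r assume r: "r \<in> {0<..<R}"
    then have rI: "r \<in> I" using I(3) by blast
    have "(v has_real_derivative v' r) (at r within I)"
      by (rule DERIV_subset[OF d[OF subsetD[OF I(4) rI]] I(4)])
    moreover have "spow (1 / (1 + \<alpha>)) (spow (1 + \<alpha>) (v' r)) = v' r"
      using p_pos by (intro spow_inverse) simp
    ultimately show "(v has_real_derivative spow (1 / (1 + \<alpha>)) (spow (1 + \<alpha>) (v' r))) (at r)"
      by (simp only: at_within_open[OF rI I(1)])
    show "((\<lambda>r. spow (1 + \<alpha>) (v' r)) has_real_derivative
      rhs \<mu> r (v r) (spow (1 + \<alpha>) (v' r))) (at r)" by (rule q'[OF rI])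
  qed
qed

lemma ivp_solution_imp_solution:
  assumes "radial_ivp_solution N \<alpha> a A c w"
  obtains q where "w 0 = c" "\<And>R. solution 1 R w q"
proof -
  obtain w' where w: "C1_on {0..} w w'" "w 0 = c" "w' 0 = 0"
    "radial_pucci_eq N \<alpha> a A {0<..} w' (\<lambda>r. - (\<bar>w r\<bar> powr \<alpha> * w r))"
    using assms by (auto simp: radial_ivp_solution_def)
  have "solution 1 R w (\<lambda>r. spow (1 + \<alpha>) (w' r))" for R
    by (rule solution_if_C1_on[OF w(1) _ _ w(3), where I = "{0<..}"])
      (use w(4) in \<open>auto simp: is_interval_ci is_interval_oi\<close>)
  then show ?thesis using that w(2) by blast
qed

lemma eigenfunction_imp_solution:
  assumes "radial_eigenfunction N \<alpha> a A \<mu> v"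
  obtains q where "solution \<mu> 1 v q" "v 1 = 0" "\<exists>r\<in>{0..1}. v r \<noteq> 0"
proof -
  obtain v' where v: "C1_on {0..1} v v'" "v' 0 = 0" "v 1 = 0" "\<exists>r\<in>{0..1}. v r \<noteq> 0"
    "radial_pucci_eq N \<alpha> a A {0<..<1} v' (\<lambda>r. - \<mu> * (\<bar>v r\<bar> powr \<alpha> * v r))"
    using assms by (auto simp: radial_eigenfunction_def)
  have "solution \<mu> 1 v (\<lambda>r. spow (1 + \<alpha>) (v' r))"
    by (rule solution_if_C1_on[OF v(1) _ _ v(2), where I = "{0<..<1}"])
      (use v(5) in \<open>auto simp: is_interval_cc is_interval_oo\<close>)
  then show ?thesis using that v by blast
qed

text \<open>
  The system gives a derivative of \<open>v\<close> only at interior points, so the condition at the origin is a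
  hypothesis; \<open>R > 1\<close> makes \<open>r = 1\<close> interior. Where \<open>v'\<close> is nonzero it is the smooth branch of a root of the
  \<open>C\<^sup>1\<close> function \<open>q\<close>.
\<close>

lemma solution_imp_eigenfunction:
  assumes sol: "solution \<mu> R v q" and R: "R > 1" and v: "v 1 = 0" "v 0 \<noteq> 0"
    and v0: "(v has_real_derivative 0) (at 0 within {0..})"
  shows "radial_eigenfunction N \<alpha> a A \<mu> v"
proof -
  define v' where "v' r = spow (1 / (1 + \<alpha>)) (q r)" for r
  define v'' where "v'' r = 1 / (1 + \<alpha>) * \<bar>q r\<bar> powr (1 / (1 + \<alpha>) - 1) * rhs \<mu> r (v r) (q r)" for r
  have p: "1 + \<alpha> > 0" by (rule p_pos)
  have q0: "q 0 = 0" using sol by (simp add: solution_def)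
  have I01: "{0..1} \<subseteq> {0..R}" using R by auto
  note cont = solution_continuous[OF sol I01]
  have v'_cont: "continuous_on {0..1} v'"
    unfolding v'_def using p by (intro continuous_on_spow cont) simp
  have q_eq: "spow (1 + \<alpha>) (v' r) = q r" for r
    using spow_inverse[of "1 / (1 + \<alpha>)" "q r"] p by (simp add: v'_def)
  have C1: "C1_on {0..1} v v'"
    unfolding C1_on_def
  proof (intro conjI ballI v'_cont)
    fix r :: real assume r: "r \<in> {0..1}"
    show "(v has_real_derivative v' r) (at r within {0..1})"
    proof (cases "r = 0")
      case True
      then show ?thesis using v0 q0 by (auto simp: v'_def intro: DERIV_subset)
    next
      case False
      then show ?thesis
        using solution_derivative(1)[OF sol, of r] r R
        by (auto simp: v'_def intro: has_field_derivative_at_within)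
    qed
  qed
  have v'_nz: "v' r \<noteq> 0 \<longleftrightarrow> q r \<noteq> 0" for r by (simp add: v'_def)
  have D: "(v' has_real_derivative v'' r) (at r within {0..1})" if r: "r \<in> {0..1}" "v' r \<noteq> 0" for r
  proof -
    have "q r \<noteq> 0" "r \<noteq> 0" using r q0 by (auto simp: v'_nz)
    then have "0 < r" "r < R" using r R by auto
    show ?thesis
      unfolding v'_def[abs_def] v''_def
      by (rule has_field_derivative_at_within, rule DERIV_chain2,
          rule spow_has_derivative[OF \<open>q r \<noteq> 0\<close>],
          rule solution_derivative(2)[OF sol \<open>0 < r\<close> \<open>r < R\<close>])
  qed
  have v''_cont: "continuous_on {r \<in> {0..1}. v' r \<noteq> 0} v''"
  proof -
    let ?S = "{r \<in> {0..1}. v' r \<noteq> 0}"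
    have S: "?S \<subseteq> {0..1}" by blast
    have qS: "continuous_on ?S q" and vS: "continuous_on ?S v"
      using cont S by (auto intro: continuous_on_subset)
    have "0 \<notin> ?S" using q0 by (simp add: v'_def)
    then have nz: "\<forall>r\<in>?S. r \<noteq> 0" by metis
    have "continuous_on ?S (\<lambda>r. - \<mu> * spow (1 + \<alpha>) (v r) - (real N - 1) / r * G (q r))"
      by (intro continuous_intros continuous_on_spow p_pos vS nz
          continuous_on_compose2[OF G_continuous[of UNIV] qS]) simp
    from continuous_on_compose2[OF Ginv_continuous[of UNIV] this]
    have "continuous_on ?S (\<lambda>r. rhs \<mu> r (v r) (q r))"
      unfolding rhs_def by (intro continuous_intros) auto
    moreover have "continuous_on ?S (\<lambda>r. \<bar>q r\<bar> powr (1 / (1 + \<alpha>) - 1))"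
      by (intro continuous_on_powr continuous_intros qS) (auto simp: v'_nz)
    ultimately show ?thesis
      unfolding v''_def by (intro continuous_on_mult continuous_on_const)
  qed
  have v'_ioo: "continuous_on {0<..<1} v'" and v_ioo: "continuous_on {0<..<1} v"
    by (rule continuous_on_subset[OF v'_cont] continuous_on_subset[OF cont(1)]; auto)+
  have "continuous_on {0<..<1} (\<lambda>r. - \<mu> * (\<bar>v r\<bar> powr \<alpha> * v r))"
    unfolding powr_abs_mult_eq_spow
    by (intro continuous_intros continuous_on_spow p_pos v_ioo)
  then have "radial_pucci_eq N \<alpha> a A {0<..<1} v' (\<lambda>r. - \<mu> * (\<bar>v r\<bar> powr \<alpha> * v r))"
    using solution_derivative(2)[OF sol] R
    by (subst radial_pucci_eq_iff_classical[OF refl refl _ _ _ v'_ioo])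
      (auto simp: is_interval_oo q_eq rhs_def powr_abs_mult_eq_spow)
  moreover have "\<exists>r\<in>{0..1}. v r \<noteq> 0" using v by (intro bexI[of _ 0]) auto
  moreover have "v' 0 = 0" using q0 by (simp add: v'_def)
  ultimately show ?thesis
    unfolding radial_eigenfunction_def using v(1) C1 D v''_cont by blast
qed

lemma ivp_zero_gives_eigenfunction:
  assumes w: "radial_ivp_solution N \<alpha> a A c w" and c: "c \<noteq> 0" and l: "l > 0" "w l = 0"
  shows "radial_eigenfunction N \<alpha> a A (l powr (\<alpha> + 2)) (\<lambda>r. w (l * r))"
proof -
  obtain q where q: "w 0 = c" "\<And>R. solution 1 R w q"
    using ivp_solution_imp_solution[OF w] by metis
  \<comment> \<open>the interval \<open>[0, 2 l]\<close> for \<open>w\<close> keeps \<open>r = 1\<close> interior after the dilation\<close>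
  have scaled: "solution (l powr (\<alpha> + 2)) 2 (\<lambda>r. w (l * r)) (\<lambda>r. (1 * l) powr (1 + \<alpha>) * q (l * r))"
    using solution_scale[OF q(2)[of "2 * l"] l(1), of 1] l(1) by (simp add: add.commute)
  have D0: "((\<lambda>r. w (l * r)) has_real_derivative 0) (at 0 within {0..})"
  proof -
    obtain w' where "C1_on {0..} w w'" "w' 0 = 0"
      using w by (auto simp: radial_ivp_solution_def)
    then have "(w has_real_derivative 0) (at (l * 0) within {0..})"
      unfolding C1_on_def by (metis atLeast_iff mult_zero_right order_refl)
    then have "(w has_real_derivative 0) (at (l * 0) within (\<lambda>r. l * r) ` {0..})"
      by (rule DERIV_subset) (use l(1) in auto)
    from DERIV_image_chain[OF this, of l] show ?thesis
      by (auto simp: o_def intro!: derivative_eq_intros)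
  qed
  show ?thesis
    by (rule solution_imp_eigenfunction[OF scaled _ _ _ D0]) (use q(1) c l in auto)
qed

text \<open>
  The dilated function \<open>w\<close> whose sign at the origin is that of \<open>v\<close>, multiplied by \<open>\<bar>v 0\<bar>\<close>, solves the same
  initial value problem as \<open>v\<close>. If \<open>v 0\<close> were zero this would give \<open>v = 0\<close>.
\<close>

lemma eigenfunction_is_rescaled_ivp_solution:
  assumes v: "radial_eigenfunction N \<alpha> a A \<mu> v"
    and wp: "radial_ivp_solution N \<alpha> a A 1 wp" and wm: "radial_ivp_solution N \<alpha> a A (-1) wm"
  shows "\<mu> > 0 \<and> (\<exists>w\<in>{wp, wm}. w (\<mu> powr (1 / (2 + \<alpha>))) = 0 \<and>
    (\<exists>c>0. \<forall>r\<in>{0..1}. v r = c * w (\<mu> powr (1 / (2 + \<alpha>)) * r)))"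
proof -
  obtain q where q: "solution \<mu> 1 v q" "v 1 = 0" "\<exists>r\<in>{0..1}. v r \<noteq> 0"
    using eigenfunction_imp_solution[OF v] by metis
  have \<mu>: "\<mu> > 0"
    using solution_nonpositive_trivial[OF q(1) _ q(2)] q(3) by force
  define l where "l = \<mu> powr (1 / (2 + \<alpha>))"
  have l: "l > 0" using \<mu> by (simp add: l_def)
  have l_powr: "l powr (1 + \<alpha> + 1) = \<mu>"
    using \<mu> p_pos by (simp add: l_def powr_powr)
  define w where "w = (if v 0 \<ge> 0 then wp else wm)"
  obtain qp where qp: "wp 0 = 1" "\<And>R. solution 1 R wp qp"
    using ivp_solution_imp_solution[OF wp] by metis
  obtain qm where qm: "wm 0 = -1" "\<And>R. solution 1 R wm qm"
    using ivp_solution_imp_solution[OF wm] by metis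
  obtain qw where qw: "solution 1 l w qw"
    using qp(2) qm(2) by (cases "v 0 \<ge> 0") (auto simp: w_def)
  have "l / l = 1" using l by simp
  with solution_scale[OF qw l, of "\<bar>v 0\<bar>"]
  have scaled: "solution \<mu> 1 (\<lambda>r. \<bar>v 0\<bar> * w (l * r)) (\<lambda>r. (\<bar>v 0\<bar> * l) powr (1 + \<alpha>) * qw (l * r))"
    by (simp only: l_powr abs_ge_zero)
  have "v 0 = \<bar>v 0\<bar> * w (l * 0)"
    by (simp add: w_def qp(1) qm(1))
  then have eq: "v r = \<bar>v 0\<bar> * w (l * r)" if "r \<in> {0..1}" for r
    by (rule solution_unique[OF q(1) scaled \<mu> _ that])
  obtain r0 where r0: "r0 \<in> {0..1}" "v r0 \<noteq> 0" using q(3) by blast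
  have "\<bar>v 0\<bar> > 0" using eq[OF r0(1)] r0(2) by (cases "v 0 = 0") simp_all
  moreover from this have "w l = 0" using eq[of 1] q(2) by simp
  moreover have "w \<in> {wp, wm}" by (simp add: w_def)
  ultimately show ?thesis
    using \<mu> eq unfolding l_def[symmetric] by blast
qed

end

theorem proposition5p3:
  fixes N :: nat and \<alpha> a A :: real
    and wp wm :: "real \<Rightarrow> real" and \<beta>p \<beta>m \<mu>p \<mu>m :: "nat \<Rightarrow> real"
  assumes "N \<ge> 1" and "\<alpha> > -1" and "0 < a" and "a \<le> A"
    and "radial_ivp_solution N \<alpha> a A 1 wp"
    and "radial_ivp_solution N \<alpha> a A (-1) wm"
    and "increasing_positive_zeros wp \<beta>p"
    and "increasing_positive_zeros wm \<beta>m"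
    and "\<And>k. k \<ge> 1 \<Longrightarrow> \<mu>p k = \<beta>p k powr (\<alpha> + 2)"
    and "\<And>k. k \<ge> 1 \<Longrightarrow> \<mu>m k = \<beta>m k powr (\<alpha> + 2)"
  shows "{\<mu>. radial_eigenvalue N \<alpha> a A \<mu>} = \<mu>p ` {1..} \<union> \<mu>m ` {1..}
    \<and> (\<forall>k\<ge>1. \<forall>v. radial_eigenfunction N \<alpha> a A (\<mu>p k) v \<longrightarrow>
          (\<exists>c>0. \<forall>r\<in>{0..1}. v r = c * wp (\<mu>p k powr (1 / (2 + \<alpha>)) * r))
          \<or> \<mu>p k \<in> \<mu>m ` {1..} \<and>
            (\<exists>c>0. \<forall>r\<in>{0..1}. v r = c * wm (\<mu>p k powr (1 / (2 + \<alpha>)) * r)))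
    \<and> (\<forall>k\<ge>1. \<forall>v. radial_eigenfunction N \<alpha> a A (\<mu>m k) v \<longrightarrow>
          (\<exists>c>0. \<forall>r\<in>{0..1}. v r = c * wm (\<mu>m k powr (1 / (2 + \<alpha>)) * r))
          \<or> \<mu>m k \<in> \<mu>p ` {1..} \<and>
            (\<exists>c>0. \<forall>r\<in>{0..1}. v r = c * wp (\<mu>m k powr (1 / (2 + \<alpha>)) * r)))"
proof -
  have zero_iff: "\<mu> \<in> \<mu>s ` {1..} \<longleftrightarrow> w (\<mu> powr (1 / (2 + \<alpha>))) = 0"
    if "\<mu> > 0" "increasing_positive_zeros w \<beta>" "\<And>k. k \<ge> 1 \<Longrightarrow> \<mu>s k = \<beta> k powr (\<alpha> + 2)"
    for \<mu> w \<beta> and \<mu>s :: "nat \<Rightarrow> real"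
  proof -
    have range: "\<beta> ` {1..} = {r. r > 0 \<and> w r = 0}"
      using that(2) by (simp add: increasing_positive_zeros_def)
    have root: "\<mu> = \<beta> k powr (\<alpha> + 2) \<longleftrightarrow> \<beta> k = \<mu> powr (1 / (2 + \<alpha>))" if "k \<ge> 1" for k
    proof -
      have "\<beta> k > 0" using range that by blast
      then show ?thesis
        using \<open>\<mu> > 0\<close> \<open>\<alpha> > -1\<close> by (auto simp: powr_powr add.commute)
    qed
    have "\<mu> \<in> \<mu>s ` {1..} \<longleftrightarrow> \<mu> powr (1 / (2 + \<alpha>)) \<in> \<beta> ` {1..}"
    proof -
      have "\<mu> = \<mu>s k \<longleftrightarrow> \<mu> powr (1 / (2 + \<alpha>)) = \<beta> k" if k: "k \<in> {1..}" for k
        using root[of k] \<open>\<And>k. k \<ge> 1 \<Longrightarrow> \<mu>s k = \<beta> k powr (\<alpha> + 2)\<close>[of k] k by auto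
      then show ?thesis unfolding image_iff by (intro bex_cong refl)
    qed
    then show ?thesis using \<open>\<mu> > 0\<close> unfolding range by simp
  qed
  note zp = zero_iff[OF _ assms(7,9)] and zm = zero_iff[OF _ assms(8,10)]
  note rep = eigenfunction_is_rescaled_ivp_solution[OF assms(1-4) _ assms(5,6)]
  have eigenvalue: "radial_eigenvalue N \<alpha> a A (\<beta> k powr (\<alpha> + 2))"
    if "radial_ivp_solution N \<alpha> a A c w" "c \<noteq> 0" "increasing_positive_zeros w \<beta>" "k \<ge> 1" for c w \<beta> k
  proof -
    have "\<beta> k > 0" "w (\<beta> k) = 0"
      using that(3,4) by (auto simp: increasing_positive_zeros_def)
    then show ?thesis
      unfolding radial_eigenvalue_def
      using ivp_zero_gives_eigenfunction[OF assms(1-4) that(1,2)] by blast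
  qed
  have "{\<mu>. radial_eigenvalue N \<alpha> a A \<mu>} = \<mu>p ` {1..} \<union> \<mu>m ` {1..}"
  proof (intro equalityI subsetI)
    fix \<mu> assume "\<mu> \<in> {\<mu>. radial_eigenvalue N \<alpha> a A \<mu>}"
    then obtain v where "radial_eigenfunction N \<alpha> a A \<mu> v"
      by (auto simp: radial_eigenvalue_def)
    from rep[OF this] show "\<mu> \<in> \<mu>p ` {1..} \<union> \<mu>m ` {1..}"
      using zp[of \<mu>] zm[of \<mu>] by auto
  next
    fix \<mu> assume "\<mu> \<in> \<mu>p ` {1..} \<union> \<mu>m ` {1..}"
    then show "\<mu> \<in> {\<mu>. radial_eigenvalue N \<alpha> a A \<mu>}"
      using eigenvalue[OF assms(5) _ assms(7)] eigenvalue[OF assms(6) _ assms(8)] assms(9,10)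
      by auto
  qed
  moreover have "(\<exists>c>0. \<forall>r\<in>{0..1}. v r = c * wp (\<mu> powr (1 / (2 + \<alpha>)) * r)) \<and> \<mu> \<in> \<mu>p ` {1..} \<or>
      (\<exists>c>0. \<forall>r\<in>{0..1}. v r = c * wm (\<mu> powr (1 / (2 + \<alpha>)) * r)) \<and> \<mu> \<in> \<mu>m ` {1..}"
    if "radial_eigenfunction N \<alpha> a A \<mu> v" for \<mu> v
    using rep[OF that] zp[of \<mu>] zm[of \<mu>] by blast
  ultimately show ?thesis by blast
qed

end
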